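(* (1) Suppose $(\mathfrak P_t)_{t\ge0}$ is a strongly continuous semigroup of Markov operators on a compact metric space $\mathcal X$. Assume that for each $t>0$ the operator $\mathfrak P_t$ is strong Feller and admits $\rho$ as its unique invariant probability measure. Then there exist $C,c>0$ such that for all $t\ge0$, $$\sup_{\phi\in\mathcal X}\big\|\rho-\mathfrak P_t^*\delta_\phi\big\|_{TV}\le Ce^{-ct},$$ where $\mathfrak P_t^*$ is the adjoint Markov semigroup acting on measures and $\delta_\phi$ denotes the Dirac mass at $\phi\in\mathcal X$. (2) Let $\mathfrak P$ be a strong Feller Markov operator on a compact metric space $\mathcal X$, and let $\mathfrak P_*$ denote the adjoint operator on measures. Assume that $\mathfrak P_*^N\delta_\phi-\mathfrak P_*^N\delta_\psi$ converges weakly to $0$ as $N\to\infty$ for all $\phi,\psi\in\mathcal X$, i.e. $\lim_{N\to\infty}|\mathfrak P^NF(\phi)-\mathfrak P^NF(\psi)|=0$ for all $\phi,\psi\in\mathcal X$ and all Lipschitz continuous $F:\mathcal X\to\mathbb R$. Then there exist $C,c>0$ such that for all $N\in\mathbb N$, $$\sup_{\phi,\psi\in\mathcal X}\|\mathfrak P_*^N\delta_\phi-\mathfrak P_*^N\delta_\psi\|_{TV}\le Ce^{-cN}.$$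
   Context: A Markov operator on a metric space $\mathcal X$ is an operator $\mathfrak PF(\phi)=\int F\,d\nu_\phi$ on bounded measurable functions induced by a Borel-measurable family of probability measures (a probability kernel) $(\nu_\phi)_{\phi\in\mathcal X}$; its adjoint acts on measures, with $\mathfrak P_*\delta_\phi=\nu_\phi$. It is strong Feller if it maps bounded measurable functions to bounded continuous functions. A semigroup $(\mathfrak P_t)_{t\ge 0}$ satisfies $\mathfrak P_0=I$, $\mathfrak P_{t+s}=\mathfrak P_t\mathfrak P_s$; strongly continuous means $\|\mathfrak P_tF-F\|_{\infty}\to0$ as $t\downarrow0$ for all $F\in C(\mathcal X)$. $\|\cdot\|_{TV}$ is the total variation norm on signed Borel measures. *)

theory Defs
  imports "HOL-Probability.Probability"
begin

text \<open>
  Markov operators are represented by the probability kernels that induce them; the kernel is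
  determined by its operator (apply the operator to indicator functions). Measurability into
  \<^term>\<open>prob_algebra borel\<close> means that each \<open>\<nu> \<phi>\<close> is a Borel probability measure and
  that \<open>\<phi> \<mapsto> \<nu> \<phi> A\<close> is Borel for every Borel set \<open>A\<close>.
\<close>

definition markov_kernel :: "('a::topological_space \<Rightarrow> 'a measure) \<Rightarrow> bool" where
  "markov_kernel \<nu> \<longleftrightarrow> \<nu> \<in> borel \<rightarrow>\<^sub>M prob_algebra borel"

definition markov_op :: "('a \<Rightarrow> 'a measure) \<Rightarrow> ('a \<Rightarrow> real) \<Rightarrow> 'a \<Rightarrow> real" where
  "markov_op \<nu> F = (\<lambda>\<phi>. \<integral>\<psi>. F \<psi> \<partial>\<nu> \<phi>)"

definition markov_adjoint :: "('a \<Rightarrow> 'a measure) \<Rightarrow> 'a measure \<Rightarrow> 'a measure" where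
  "markov_adjoint \<nu> \<mu> = \<mu> \<bind> \<nu>"

definition bounded_measurable :: "('a::topological_space \<Rightarrow> real) \<Rightarrow> bool" where
  "bounded_measurable F \<longleftrightarrow> F \<in> borel_measurable borel \<and> bounded (range F)"

definition strong_feller :: "('a::topological_space \<Rightarrow> 'a measure) \<Rightarrow> bool" where
  "strong_feller \<nu> \<longleftrightarrow>
     (\<forall>F. bounded_measurable F \<longrightarrow>
        continuous_on UNIV (markov_op \<nu> F) \<and> bounded (range (markov_op \<nu> F)))"

definition invariant_prob :: "('a::topological_space \<Rightarrow> 'a measure) \<Rightarrow> 'a measure \<Rightarrow> bool" where
  "invariant_prob \<nu> \<mu> \<longleftrightarrow>
     prob_space \<mu> \<and> sets \<mu> = sets borel \<and> markov_adjoint \<nu> \<mu> = \<mu>"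

definition unique_invariant_prob :: "('a::topological_space \<Rightarrow> 'a measure) \<Rightarrow> 'a measure \<Rightarrow> bool" where
  "unique_invariant_prob \<nu> \<rho> \<longleftrightarrow>
     invariant_prob \<nu> \<rho> \<and> (\<forall>\<mu>. invariant_prob \<nu> \<mu> \<longrightarrow> \<mu> = \<rho>)"

definition sup_norm :: "('a \<Rightarrow> real) \<Rightarrow> ennreal" where
  "sup_norm F = (SUP \<phi>. ennreal \<bar>F \<phi>\<bar>)"

text \<open>Only the values \<open>\<nu> t\<close> with \<open>t \<ge> 0\<close> are relevant.\<close>

definition markov_semigroup :: "(real \<Rightarrow> 'a::topological_space \<Rightarrow> 'a measure) \<Rightarrow> bool" where
  "markov_semigroup \<nu> \<longleftrightarrow>
     (\<forall>t\<ge>0. markov_kernel (\<nu> t)) \<and>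
     (\<forall>F. bounded_measurable F \<longrightarrow> markov_op (\<nu> 0) F = F) \<and>
     (\<forall>t\<ge>0. \<forall>s\<ge>0. \<forall>F. bounded_measurable F \<longrightarrow>
        markov_op (\<nu> (t + s)) F = markov_op (\<nu> t) (markov_op (\<nu> s) F))"

definition strongly_continuous :: "(real \<Rightarrow> 'a::topological_space \<Rightarrow> 'a measure) \<Rightarrow> bool" where
  "strongly_continuous \<nu> \<longleftrightarrow>
     (\<forall>F. continuous_on UNIV F \<longrightarrow>
        ((\<lambda>t. sup_norm (\<lambda>\<phi>. markov_op (\<nu> t) F \<phi> - F \<phi>)) \<longlongrightarrow> 0) (at_right 0))"

text \<open>
  A finite signed Borel measure is represented by its set function \<open>m\<close>, and its total variation
  norm is \<open>\<bar>m\<bar>(X)\<close>, the supremum of \<open>\<Sum>\<bar>m A\<bar>\<close> over finite Borel partitions of the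
  space (so two mutually singular probability measures are at distance 2).
\<close>

definition tv_norm :: "('a::topological_space set \<Rightarrow> real) \<Rightarrow> ennreal" where
  "tv_norm m =
     (SUP \<A>\<in>{\<A>. finite \<A> \<and> partition_on UNIV \<A> \<and> \<A> \<subseteq> sets borel}.
        \<Sum>A\<in>\<A>. ennreal \<bar>m A\<bar>)"

definition diff_measure_fun :: "'a measure \<Rightarrow> 'a measure \<Rightarrow> 'a set \<Rightarrow> real" where
  "diff_measure_fun \<mu> \<mu>' = (\<lambda>A. measure \<mu> A - measure \<mu>' A)"

lemma markov_adjoint_return:
  assumes "markov_kernel \<nu>"
  shows "markov_adjoint \<nu> (return borel \<phi>) = \<nu> \<phi>"
  unfolding markov_adjoint_def
  by (rule bind_return[where N = borel])
     (use assms in \<open>auto simp: markov_kernel_def intro: measurable_prob_algebraD\<close>)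

lemma integral_markov_adjoint:
  assumes "markov_kernel \<nu>" "prob_space \<mu>" "sets \<mu> = sets borel" "bounded_measurable F"
  shows "(\<integral>\<psi>. F \<psi> \<partial>markov_adjoint \<nu> \<mu>) = (\<integral>\<phi>. markov_op \<nu> F \<phi> \<partial>\<mu>)"
proof -
  obtain B where B: "\<And>x. \<bar>F x\<bar> \<le> B"
    using assms(4) by (auto simp: bounded_measurable_def bounded_iff)
  have F: "F \<in> borel_measurable borel"
    using assms(4) by (simp add: bounded_measurable_def)
  have K: "\<nu> \<in> borel \<rightarrow>\<^sub>M subprob_algebra borel"
    using assms(1) by (auto simp: markov_kernel_def intro: measurable_prob_algebraD)
  have space1: "emeasure (\<nu> x) (space (\<nu> x)) \<le> 1" for x
    using measurable_space[OF K, of x]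
    by (auto simp: space_subprob_algebra intro: subprob_space.emeasure_space_le_1)
  interpret prob_space \<mu> by fact
  show ?thesis
    unfolding markov_adjoint_def markov_op_def
  proof (rule integral_bind[where K = borel and B' = 1 and B = B])
    show "\<nu> \<in> \<mu> \<rightarrow>\<^sub>M subprob_algebra borel"
      using K assms(3) by (simp cong: measurable_cong_sets)
  qed (use F B assms not_empty space1 in \<open>auto\<close>)
qed

end

theory Submission
  imports Defs "HOL-Library.Diagonal_Subsequence"
begin

text \<open>
  If \<open>P\<close> is strong Feller on a compact space, all \<open>\<nu> x\<close> have densities with respect to one
  probability measure, so every bounded sequence has a subsequence along which \<open>P F\<^sub>n\<close> converges
  pointwise; by Dini's theorem \<open>P (P F\<^sub>n)\<close> then converges uniformly. Hence if all limit points of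
  orbits \<open>P\<^sup>n H\<close> of continuous functions are constant, some power of \<open>P\<close> halves the oscillation of
  every bounded measurable function, and the decay in total variation is geometric.

  Under weak asymptotic stability the limit points are constant because Lipschitz functions are
  dense. For a semigroup, take \<open>P\<close> to be the operator at time 1. A limit point \<open>G\<close> is recurrent, so its
  \<open>L\<^sup>2(\<rho>)\<close> norm is preserved, and equality in Jensen's inequality makes \<open>P\<close> act deterministically
  on \<open>G\<close> over the support of \<open>\<rho>\<close>. The strong Feller property then leaves only finitely many
  values of \<open>P G\<close> there, so \<open>P\<^sup>n (P G) = P G\<close> on the support for some \<open>n > 0\<close>, and uniqueness of the
  invariant measure of \<open>P\<^sup>n\<close> allows only one value. Off the support the orbit is transient, because a
  Krylov--Bogoliubov limit charging the complement of the support would be a second invariant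
  measure.
\<close>

section \<open>Markov operators on bounded measurable functions\<close>

text \<open>Total variation is dual to test functions bounded by 1, so both rates reduce to one
  quantity: the oscillation of P^n F, uniformly over that unit ball. The uniformity is the obstacle:
  constancy of limit points concerns one continuous function at a time, and the ball is not compact
  in the sup norm. Its image under P^2 is relatively compact, and a contradiction argument then
  yields one exponent for all test functions. Linearity does the rest: halving every
  \<open>N\<close> steps gives the rate \<open>ln 2 / N\<close>, and the constant 4 is 2 for the
  initial oscillation times 2 for an incomplete block. For the semigroup the danger is periodicity:
  swapping the points of a two-point space is strong Feller with a unique invariant measure, yet its
  orbits never settle. Unique ergodicity at all integer times excludes this, since P^n is the
  operator at time n. A limit point of an orbit need not be an eigenfunction; what it retains is
  uniform return to itself at late times, and this already forbids any loss of energy.\<close>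

lemma bounded_measurableI:
  assumes "F \<in> borel_measurable borel" "\<And>x. \<bar>F x\<bar> \<le> B"
  shows "bounded_measurable F"
  using assms by (auto simp: bounded_measurable_def bounded_iff)

lemma bounded_measurableE:
  assumes "bounded_measurable F"
  obtains B where "B \<ge> 0" "\<And>x. \<bar>F x\<bar> \<le> B"
proof -
  obtain B where B: "\<And>x. \<bar>F x\<bar> \<le> B"
    using assms by (auto simp: bounded_measurable_def bounded_iff)
  show ?thesis using B[of undefined] by (intro that[of B] B) auto
qed

lemma bounded_measurable_measurable:
  "bounded_measurable F \<Longrightarrow> F \<in> borel_measurable borel"
  by (simp add: bounded_measurable_def)

lemma bounded_measurable_const: "bounded_measurable (\<lambda>_. c)"
  by (rule bounded_measurableI[where B = "\<bar>c\<bar>"]) auto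

lemma bounded_measurable_indicator:
  "A \<in> sets borel \<Longrightarrow> bounded_measurable (indicator A)"
  by (rule bounded_measurableI[where B = 1]) (auto simp: indicator_def)

lemma bounded_measurable_add:
  assumes "bounded_measurable F" "bounded_measurable G"
  shows "bounded_measurable (\<lambda>x. F x + G x)"
proof -
  obtain B C where "\<And>x. \<bar>F x\<bar> \<le> B" "\<And>x. \<bar>G x\<bar> \<le> C"
    using assms by (auto elim!: bounded_measurableE)
  then have "\<bar>F x + G x\<bar> \<le> B + C" for x
    by (meson abs_triangle_ineq add_mono order_trans)
  then show ?thesis using assms[THEN bounded_measurable_measurable]
    by (intro bounded_measurableI borel_measurable_add borel_measurable_times)
qed

lemma bounded_measurable_mult:
  assumes "bounded_measurable F" "bounded_measurable G"
  shows "bounded_measurable (\<lambda>x. F x * G x)"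
proof -
  obtain B C where "B \<ge> 0" "\<And>x. \<bar>F x\<bar> \<le> B" "\<And>x. \<bar>G x\<bar> \<le> C"
    using assms by (auto elim!: bounded_measurableE)
  then have "\<bar>F x * G x\<bar> \<le> B * C" for x
    by (auto simp: abs_mult intro!: mult_mono)
  then show ?thesis using assms[THEN bounded_measurable_measurable]
    by (intro bounded_measurableI borel_measurable_add borel_measurable_times)
qed

lemma bounded_measurable_cmult:
  "bounded_measurable F \<Longrightarrow> bounded_measurable (\<lambda>x. c * F x)"
  by (rule bounded_measurable_mult[OF bounded_measurable_const])

lemma bounded_measurable_diff:
  assumes "bounded_measurable F" "bounded_measurable G"
  shows "bounded_measurable (\<lambda>x. F x - G x)"
  using bounded_measurable_add[OF assms(1) bounded_measurable_cmult[OF assms(2), of "-1"]] by simp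

lemma bounded_measurable_abs:
  assumes "bounded_measurable F" shows "bounded_measurable (\<lambda>x. \<bar>F x\<bar>)"
proof -
  obtain B where "\<And>x. \<bar>F x\<bar> \<le> B" using assms by (rule bounded_measurableE) auto
  then show ?thesis using bounded_measurable_measurable[OF assms] by (intro bounded_measurableI[where B = B]) auto
qed

lemma bounded_measurable_power2:
  "bounded_measurable F \<Longrightarrow> bounded_measurable (\<lambda>x. (F x)\<^sup>2)"
  unfolding power2_eq_square by (rule bounded_measurable_mult)

lemma bounded_measurable_sum:
  assumes "\<And>i. i \<in> I \<Longrightarrow> bounded_measurable (F i)"
  shows "bounded_measurable (\<lambda>x. \<Sum>i\<in>I. F i x)"
  using assms
  by (induction I rule: infinite_finite_induct)
     (auto simp: bounded_measurable_const intro!: bounded_measurable_add)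

lemmas bounded_measurable_intros =
  bounded_measurable_const bounded_measurable_indicator bounded_measurable_add
  bounded_measurable_mult bounded_measurable_cmult bounded_measurable_diff bounded_measurable_abs
  bounded_measurable_power2 bounded_measurable_sum

lemma bounded_measurable_continuous:
  fixes F :: "'a::topological_space \<Rightarrow> real"
  assumes "compact (UNIV :: 'a set)" "continuous_on UNIV F"
  shows "bounded_measurable F"
  unfolding bounded_measurable_def
  using compact_imp_bounded[OF compact_continuous_image[OF assms(2,1)]]
    borel_measurable_continuous_onI[OF assms(2)] by simp

lemma integrable_bounded_measurable:
  assumes "prob_space M" "sets M = sets borel" "bounded_measurable F"
  shows "integrable M F"
proof -
  interpret prob_space M by fact
  obtain B where "\<And>x. \<bar>F x\<bar> \<le> B" using assms(3) by (rule bounded_measurableE) auto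
  moreover have "F \<in> borel_measurable M"
    using bounded_measurable_measurable[OF assms(3)] assms(2) by (simp cong: measurable_cong_sets)
  ultimately show ?thesis by (intro integrable_const_bound[where B = B]) auto
qed

lemma integral_bounds:
  assumes M: "prob_space M" "sets M = sets borel" and "bounded_measurable F"
    and F: "\<And>x. a \<le> F x" "\<And>x. F x \<le> b"
  shows "a \<le> (\<integral>x. F x \<partial>M)" "(\<integral>x. F x \<partial>M) \<le> b"
proof -
  interpret prob_space M by fact
  note I = integrable_bounded_measurable[OF M assms(3)]
  show "a \<le> (\<integral>x. F x \<partial>M)" "(\<integral>x. F x \<partial>M) \<le> b"
    using integral_mono[OF _ I, of "\<lambda>_. a"] integral_mono[OF I, of "\<lambda>_. b"] F prob_space by auto
qed

lemma integral_abs_diff_le: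
  assumes M: "prob_space M" "sets M = sets borel" and FG: "bounded_measurable F" "bounded_measurable G"
    and le: "\<And>x. \<bar>F x - G x\<bar> \<le> e"
  shows "\<bar>(\<integral>x. F x \<partial>M) - (\<integral>x. G x \<partial>M)\<bar> \<le> e"
proof -
  have "(\<integral>x. F x \<partial>M) - (\<integral>x. G x \<partial>M) = (\<integral>x. F x - G x \<partial>M)"
    using integrable_bounded_measurable[OF M] FG by simp
  moreover have "-e \<le> F x - G x" "F x - G x \<le> e" for x
    using le[of x] by auto
  from integral_bounds[OF M bounded_measurable_diff[OF FG] this]
  have "-e \<le> (\<integral>x. F x - G x \<partial>M)" "(\<integral>x. F x - G x \<partial>M) \<le> e" .
  ultimately show ?thesis by auto
qed

section \<open>Kernels and their integral operators\<close>

lemma markov_kernelD: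
  assumes "markov_kernel \<nu>"
  shows "prob_space (\<nu> x)" "sets (\<nu> x) = sets borel" "space (\<nu> x) = UNIV"
    and "\<nu> \<in> borel \<rightarrow>\<^sub>M subprob_algebra borel"
proof -
  have "\<nu> x \<in> space (prob_algebra borel)"
    using assms measurable_space[of \<nu> borel "prob_algebra borel" x] by (simp add: markov_kernel_def)
  then show "prob_space (\<nu> x)" "sets (\<nu> x) = sets borel"
    by (auto simp: space_prob_algebra)
  then show "space (\<nu> x) = UNIV" by (metis sets_eq_imp_space_eq space_borel)
  show "\<nu> \<in> borel \<rightarrow>\<^sub>M subprob_algebra borel"
    using assms by (auto simp: markov_kernel_def intro: measurable_prob_algebraD)
qed

lemma integrable_markov_kernel:
  "markov_kernel \<nu> \<Longrightarrow> bounded_measurable F \<Longrightarrow> integrable (\<nu> x) F"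
  by (intro integrable_bounded_measurable markov_kernelD)

lemma markov_op_bounds:
  assumes "markov_kernel \<nu>" "bounded_measurable F" "\<And>x. a \<le> F x" "\<And>x. F x \<le> b"
  shows "a \<le> markov_op \<nu> F y" "markov_op \<nu> F y \<le> b"
  unfolding markov_op_def using assms by (auto intro!: integral_bounds markov_kernelD)

lemma markov_op_abs_le:
  assumes "markov_kernel \<nu>" "bounded_measurable F" "\<And>x. \<bar>F x\<bar> \<le> b"
  shows "\<bar>markov_op \<nu> F y\<bar> \<le> b"
  using markov_op_bounds[OF assms(1,2), of "-b" b y] assms(3) by (simp add: abs_le_iff minus_le_iff)

lemma bounded_measurable_markov_op:
  assumes "markov_kernel \<nu>" "bounded_measurable F"
  shows "bounded_measurable (markov_op \<nu> F)"
proof -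
  obtain B where B: "\<And>x. \<bar>F x\<bar> \<le> B" using assms(2) by (rule bounded_measurableE) auto
  show ?thesis
  proof (rule bounded_measurableI)
    have "(\<lambda>M. integral\<^sup>L M F) \<in> borel_measurable (subprob_algebra borel)"
      using bounded_measurable_measurable[OF assms(2)] by measurable
    from measurable_compose[OF markov_kernelD(4)[OF assms(1)] this]
    show "markov_op \<nu> F \<in> borel_measurable borel"
      by (simp add: markov_op_def cong: measurable_cong)
    show "\<bar>markov_op \<nu> F x\<bar> \<le> B" for x by (rule markov_op_abs_le[OF assms B])
  qed
qed

lemma markov_op_const: "markov_kernel \<nu> \<Longrightarrow> markov_op \<nu> (\<lambda>_. c) = (\<lambda>_. c)"
  by (simp add: markov_op_def prob_space.prob_space[OF markov_kernelD(1)])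

lemma markov_op_add:
  "markov_kernel \<nu> \<Longrightarrow> bounded_measurable F \<Longrightarrow> bounded_measurable G \<Longrightarrow>
    markov_op \<nu> (\<lambda>x. F x + G x) = (\<lambda>x. markov_op \<nu> F x + markov_op \<nu> G x)"
  by (auto simp: markov_op_def integrable_markov_kernel)

lemma markov_op_diff:
  "markov_kernel \<nu> \<Longrightarrow> bounded_measurable F \<Longrightarrow> bounded_measurable G \<Longrightarrow>
    markov_op \<nu> (\<lambda>x. F x - G x) = (\<lambda>x. markov_op \<nu> F x - markov_op \<nu> G x)"
  by (auto simp: markov_op_def integrable_markov_kernel)

lemma markov_op_cmult: "markov_op \<nu> (\<lambda>x. c * F x) = (\<lambda>x. c * markov_op \<nu> F x)"
  by (auto simp: markov_op_def)

lemma markov_op_sum: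
  assumes "markov_kernel \<nu>" "\<And>i. i \<in> I \<Longrightarrow> bounded_measurable (F i)"
  shows "markov_op \<nu> (\<lambda>x. \<Sum>i\<in>I. F i x) = (\<lambda>x. \<Sum>i\<in>I. markov_op \<nu> (F i) x)"
  using assms by (auto simp: markov_op_def integrable_markov_kernel)

lemma markov_op_mono:
  assumes "markov_kernel \<nu>" "bounded_measurable F" "bounded_measurable G" "\<And>x. F x \<le> G x"
  shows "markov_op \<nu> F y \<le> markov_op \<nu> G y"
  unfolding markov_op_def using assms by (intro integral_mono integrable_markov_kernel) auto

lemma markov_op_contract:
  assumes "markov_kernel \<nu>" "bounded_measurable F" "bounded_measurable G"
    and "\<And>x. \<bar>F x - G x\<bar> \<le> e"
  shows "\<bar>markov_op \<nu> F y - markov_op \<nu> G y\<bar> \<le> e"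
  unfolding markov_op_def
  by (rule integral_abs_diff_le[OF markov_kernelD(1,2)[OF assms(1)] assms(2-)])

lemma markov_op_indicator:
  "markov_kernel \<nu> \<Longrightarrow> A \<in> sets borel \<Longrightarrow> markov_op \<nu> (indicator A) x = measure (\<nu> x) A"
  by (simp add: markov_op_def markov_kernelD)

lemma markov_op_tendsto:
  assumes "markov_kernel \<nu>" "\<And>n. F n \<in> borel_measurable borel" "\<And>n x. \<bar>F n x\<bar> \<le> B"
    "\<And>x. (\<lambda>n. F n x) \<longlonglongrightarrow> G x"
  shows "(\<lambda>n. markov_op \<nu> (F n) y) \<longlonglongrightarrow> markov_op \<nu> G y"
  unfolding markov_op_def
proof (rule integral_dominated_convergence)
  have m: "f \<in> borel_measurable (\<nu> y)" if "f \<in> borel_measurable borel" for f :: "'a \<Rightarrow> real"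
    using that markov_kernelD(2)[OF assms(1)] by (simp cong: measurable_cong_sets)
  show "F n \<in> borel_measurable (\<nu> y)" for n by (rule m[OF assms(2)])
  show "G \<in> borel_measurable (\<nu> y)"
    by (rule m, rule borel_measurable_LIMSEQ_real[OF assms(4,2)])
  show "integrable (\<nu> y) (\<lambda>_. B)"
    by (rule integrable_markov_kernel[OF assms(1) bounded_measurable_const])
qed (use assms in auto)

text \<open>Expanding the square writes the defect in Jensen's inequality as the variance of
  \<open>F\<close> under \<open>\<nu> y\<close>. The exact identity matters: a vanishing defect will
  force a function to be almost surely constant.\<close>

lemma markov_op_power2_le:
  assumes "markov_kernel \<nu>" "bounded_measurable F"
  shows "markov_op \<nu> (\<lambda>x. (F x - markov_op \<nu> F y)\<^sup>2) y
      = markov_op \<nu> (\<lambda>x. (F x)\<^sup>2) y - (markov_op \<nu> F y)\<^sup>2"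
    and "(markov_op \<nu> F y)\<^sup>2 \<le> markov_op \<nu> (\<lambda>x. (F x)\<^sup>2) y"
proof -
  define c where "c = markov_op \<nu> F y"
  have "(\<lambda>x. (F x - c)\<^sup>2) = (\<lambda>x. ((F x)\<^sup>2 - (2 * c) * F x) + c\<^sup>2)"
    by (auto simp: power2_eq_square algebra_simps)
  then have "markov_op \<nu> (\<lambda>x. (F x - c)\<^sup>2) y
      = markov_op \<nu> (\<lambda>x. (F x)\<^sup>2) y - (2 * c) * markov_op \<nu> F y + c\<^sup>2"
    by (simp only: markov_op_add markov_op_diff markov_op_cmult markov_op_const assms
        bounded_measurable_intros)
  then show *: "markov_op \<nu> (\<lambda>x. (F x - markov_op \<nu> F y)\<^sup>2) y
      = markov_op \<nu> (\<lambda>x. (F x)\<^sup>2) y - (markov_op \<nu> F y)\<^sup>2"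
    by (simp add: c_def power2_eq_square)
  have "0 \<le> markov_op \<nu> (\<lambda>x. (F x - markov_op \<nu> F y)\<^sup>2) y"
    unfolding markov_op_def by simp
  with * show "(markov_op \<nu> F y)\<^sup>2 \<le> markov_op \<nu> (\<lambda>x. (F x)\<^sup>2) y" by simp
qed

text \<open>Iterating the adjoint on Dirac masses gives the measures of the discrete-time bound
  verbatim, and the family in \<open>x\<close> is again a kernel, so facts about one kernel apply to
  all iterates.\<close>

definition kernel_pow :: "('a::topological_space \<Rightarrow> 'a measure) \<Rightarrow> nat \<Rightarrow> 'a \<Rightarrow> 'a measure" where
  "kernel_pow \<nu> n x = (markov_adjoint \<nu> ^^ n) (return borel x)"

lemma markov_kernel_kernel_pow:
  assumes "markov_kernel \<nu>" shows "markov_kernel (kernel_pow \<nu> n)"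
proof (induction n)
  case 0
  show ?case
    by (simp add: kernel_pow_def markov_kernel_def measurable_return_prob_space cong: measurable_cong)
next
  case (Suc n)
  have "(\<lambda>x. kernel_pow \<nu> n x \<bind> \<nu>) \<in> borel \<rightarrow>\<^sub>M prob_algebra borel"
    using Suc assms unfolding markov_kernel_def by measurable
  then show ?case by (simp add: kernel_pow_def markov_kernel_def markov_adjoint_def cong: measurable_cong)
qed

text \<open>Duality reverses the order: the outermost adjoint step integrates \<open>F\<close>
  first. The induction therefore passes from \<open>F\<close> to \<open>markov_op \<nu> F\<close>,
  and \<open>F\<close> has to stay arbitrary.\<close>

lemma funpow_markov_op:
  assumes "markov_kernel \<nu>" "bounded_measurable F"
  shows "(markov_op \<nu> ^^ n) F = markov_op (kernel_pow \<nu> n) F"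
  using assms(2)
proof (induction n arbitrary: F)
  case 0
  show ?case
    by (auto simp: kernel_pow_def markov_op_def integral_return bounded_measurable_measurable[OF 0])
next
  case (Suc n)
  have "markov_op (kernel_pow \<nu> (Suc n)) F x = markov_op (kernel_pow \<nu> n) (markov_op \<nu> F) x" for x
    using integral_markov_adjoint[OF assms(1) markov_kernelD(1,2)[OF markov_kernel_kernel_pow[OF assms(1)]]
        Suc.prems, of n x]
    by (simp add: markov_op_def kernel_pow_def)
  moreover have "(markov_op \<nu> ^^ Suc n) F = (markov_op \<nu> ^^ n) (markov_op \<nu> F)"
    by (simp add: funpow_swap1)
  ultimately show ?case
    using Suc.IH[OF bounded_measurable_markov_op[OF assms(1) Suc.prems]] by auto
qed

text \<open>The semigroup law speaks of operators, the uniqueness hypothesis of kernels. This bridge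
  identifies the powers of the time 1 kernel with the kernels at integer times.\<close>

lemma markov_kernel_eqI:
  assumes "markov_kernel \<nu>" "markov_kernel \<kappa>"
    and "\<And>F. bounded_measurable F \<Longrightarrow> markov_op \<nu> F = markov_op \<kappa> F"
  shows "\<nu> = \<kappa>"
proof (rule ext, rule measure_eqI)
  fix x A
  interpret n: prob_space "\<nu> x" by (rule markov_kernelD[OF assms(1)])
  interpret k: prob_space "\<kappa> x" by (rule markov_kernelD[OF assms(2)])
  show "sets (\<nu> x) = sets (\<kappa> x)" by (simp add: markov_kernelD assms)
  assume "A \<in> sets (\<nu> x)"
  then have A: "A \<in> sets borel" by (simp add: markov_kernelD assms)
  show "emeasure (\<nu> x) A = emeasure (\<kappa> x) A"
    using fun_cong[OF assms(3)[OF bounded_measurable_indicator[OF A]], of x] A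
    by (simp add: markov_op_indicator assms n.emeasure_eq_measure k.emeasure_eq_measure)
qed

section \<open>Dini's theorem and setwise convergence\<close>

text \<open>The sets \<open>U n\<close> are open and increase with \<open>n\<close>, so a finite
  subcover is dominated by its largest index. Nonnegativity follows from the monotone limit, so the
  one-sided bound gives uniform convergence.\<close>

lemma dini:
  fixes f :: "nat \<Rightarrow> 'a::topological_space \<Rightarrow> real"
  assumes "compact (UNIV :: 'a set)" and cont: "\<And>n. continuous_on UNIV (f n)"
    and dec: "\<And>n x. f (Suc n) x \<le> f n x" and lim: "\<And>x. (\<lambda>n. f n x) \<longlonglongrightarrow> 0" and "e > 0"
  obtains N where "\<And>n x. n \<ge> N \<Longrightarrow> f n x < e"
proof -
  define U where "U n = {x. f n x < e}" for n
  have "open (U n)" for n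
    unfolding U_def by (intro open_Collect_less cont continuous_on_const)
  moreover have "UNIV \<subseteq> (\<Union>n\<in>UNIV. U n)"
  proof
    fix x
    have "eventually (\<lambda>n. f n x < e) sequentially"
      using lim \<open>e > 0\<close> by (rule order_tendstoD)
    then show "x \<in> (\<Union>n\<in>UNIV. U n)" by (auto simp: U_def eventually_sequentially)
  qed
  ultimately obtain I where I: "finite I" "UNIV \<subseteq> (\<Union>n\<in>I. U n)"
    by (meson compactE_image[OF assms(1)])
  have mono: "f n x \<le> f m x" if "m \<le> n" for m n x
    using lift_Suc_antimono_le[of "\<lambda>n. f n x"] dec that by blast
  show ?thesis
  proof (rule that[of "Max I"])
    fix n x assume n: "n \<ge> Max I"
    from I obtain m where "m \<in> I" "x \<in> U m" by auto
    with n I(1) have "m \<le> n" by (meson Max_ge order_trans)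
    from order.strict_trans1[OF mono[OF this]] \<open>x \<in> U m\<close> show "f n x < e"
      by (simp add: U_def)
  qed
qed

text \<open>Compactness is a hypothesis on \<open>UNIV\<close>, not a property of the type class, so
  second countability is built from finite nets at the scales \<open>1 / Suc n\<close>.\<close>

lemma compact_metric_countable_basis:
  assumes "compact (UNIV :: 'a::metric_space set)"
  obtains B :: "'a::metric_space set set" where "countable B" "topological_basis B"
proof -
  have "\<exists>k. finite k \<and> (UNIV :: 'a set) \<subseteq> (\<Union>x\<in>k. ball x (1 / Suc n))" for n
    using assms unfolding compact_eq_totally_bounded by simp
  then obtain k where k: "\<And>n. finite (k n)" "\<And>n. (UNIV :: 'a set) \<subseteq> (\<Union>x\<in>k n. ball x (1 / Suc n))"
    by metis
  define B where "B = (\<Union>n. (\<lambda>x. ball x (1 / Suc n)) ` k n)"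
  show ?thesis
  proof
    show "countable B" unfolding B_def using k(1) by (intro countable_UN countable_image) (auto intro: countable_finite)
    show "topological_basis B"
    proof (rule topological_basisI)
      show "b \<in> B \<Longrightarrow> open b" for b by (auto simp: B_def)
      fix U :: "'a set" and x assume "open U" "x \<in> U"
      then obtain e where e: "e > 0" "ball x e \<subseteq> U" by (auto simp: open_contains_ball)
      \<comment> \<open>The centre \<open>c\<close> is within \<open>1 / Suc n\<close> of
        \<open>x\<close>, so its ball reaches less than twice that far from
        \<open>x\<close>.\<close>
      obtain n where n: "1 / Suc n < e / 2"
        using e(1) nat_approx_posE[of "e / 2"] by auto
      obtain c where c: "c \<in> k n" "x \<in> ball c (1 / Suc n)" using k(2)[of n] by blast
      have "ball c (1 / Suc n) \<subseteq> ball x e"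
      proof
        fix y assume "y \<in> ball c (1 / Suc n)"
        then show "y \<in> ball x e" using c(2) n dist_triangle[of x y c] by (simp add: dist_commute)
      qed
      with c e show "\<exists>b\<in>B. x \<in> b \<and> b \<subseteq> U" by (auto simp: B_def)
    qed
  qed
qed

lemma countable_basis_dense_sequence:
  assumes "countable B" "topological_basis (B :: 'a::topological_space set set)"
  obtains X :: "nat \<Rightarrow> 'a::topological_space" where "\<And>U. open U \<Longrightarrow> U \<noteq> {} \<Longrightarrow> \<exists>i. X i \<in> U"
proof -
  obtain b where "b \<in> B"
    using topological_basisE[OF assms(2) open_UNIV UNIV_I] by auto
  then have B: "range (from_nat_into B) = B" using assms(1) by (intro range_from_nat_into) auto
  \<comment> \<open>For an empty basis set the choice is arbitrary; only basis sets that contain a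
    point are used.\<close>
  define X where "X i = (SOME x. x \<in> from_nat_into B i)" for i
  show ?thesis
  proof (rule that[of X])
    fix U :: "'a set" assume "open U" "U \<noteq> {}"
    then obtain x where "x \<in> U" by auto
    obtain b where b: "b \<in> B" "x \<in> b" "b \<subseteq> U"
      using topological_basisE[OF assms(2) \<open>open U\<close> \<open>x \<in> U\<close>] .
    then obtain i where "b = from_nat_into B i" using B by blast
    with b show "\<exists>i. X i \<in> U" unfolding X_def using someI[of "\<lambda>y. y \<in> b" x] by auto
  qed
qed

text \<open>A sequence of generators lets a diagonal subsequence treat all of them at once;
  stability under intersection starts the induction over disjoint unions.\<close>

lemma countable_borel_generator:
  assumes "countable B" "topological_basis (B :: 'a::topological_space set set)"
  obtains G :: "nat \<Rightarrow> 'a::topological_space set" where "Int_stable (range G)"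
    "sets borel = sigma_sets UNIV (range G)"
proof -
  \<comment> \<open>The empty family contributes \<open>UNIV\<close>, the case treated apart
    below.\<close>
  define C where "C = Inter ` {F. finite F \<and> F \<subseteq> B}"
  have "countable C"
    unfolding C_def by (intro countable_image countable_Collect_finite_subset assms)
  moreover have "C \<noteq> {}" unfolding C_def by auto
  ultimately have C: "range (from_nat_into C) = C" by (rule range_from_nat_into[rotated])
  have "Int_stable C"
  proof (rule Int_stableI)
    fix a b assume "a \<in> C" "b \<in> C"
    then obtain E F where "finite E" "E \<subseteq> B" "a = \<Inter>E" "finite F" "F \<subseteq> B" "b = \<Inter>F"
      by (auto simp: C_def)
    then show "a \<inter> b \<in> C"
      unfolding C_def by (intro image_eqI[of _ _ "E \<union> F"]) auto
  qed
  moreover have "sets borel = sigma_sets UNIV C"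
  proof -
    have "sets (borel :: 'a measure) = sigma_sets UNIV B"
      using borel_eq_countable_basis[OF assms] by (metis sets_measure_of subset_UNIV Pow_UNIV)
    also have "\<dots> = sigma_sets UNIV C"
    proof (rule sigma_sets_eqI)
      show "b \<in> sigma_sets UNIV C" if "b \<in> B" for b
        using that unfolding C_def by (intro sigma_sets.Basic image_eqI[of _ _ "{b}"]) auto
      interpret sigma_algebra UNIV "sigma_sets UNIV B" by (rule sigma_algebra_sigma_sets) auto
      show "c \<in> sigma_sets UNIV B" if "c \<in> C" for c
      proof -
        obtain F where F: "finite F" "F \<subseteq> B" "c = \<Inter>F" using \<open>c \<in> C\<close> by (auto simp: C_def)
        show ?thesis
        proof (cases "F = {}")
          case True
          then show ?thesis using F top by simp
        next
          case False
          then show ?thesis unfolding F(3) using F(1,2) finite_INT[of F "\<lambda>x. x"] by auto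
        qed
      qed
    qed
    finally show ?thesis .
  qed
  ultimately show ?thesis using that[of "from_nat_into C"] C by simp
qed

section \<open>Extraction of subsequences and passage to limits\<close>

lemma bounded_diagonal_subsequence:
  fixes f :: "nat \<Rightarrow> nat \<Rightarrow> real"
  assumes "\<And>n i. \<bar>f n i\<bar> \<le> B"
  obtains r where "strict_mono r" "\<And>i. convergent (\<lambda>k. f (r k) i)"
proof -
  interpret subseqs "\<lambda>i s. convergent (\<lambda>k. f (s k) i)"
  proof
    fix n and s :: "nat \<Rightarrow> nat"
    have "bounded (range (\<lambda>k. f (s k) n))" using assms by (auto simp: bounded_iff)
    then show "\<exists>r'. strict_mono r' \<and> convergent (\<lambda>k. f ((s \<circ> r') k) n)"
      using bounded_imp_convergent_subsequence[of "\<lambda>k. f (s k) n"]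
      by (auto simp: convergent_def o_def)
  qed
  show ?thesis
  proof (rule that[OF subseq_diagseq])
    fix i
    \<comment> \<open>The diagonal sequence is known to be a subsequence of the \<open>i\<close>-th
      extraction only from index \<open>Suc i\<close> on; a finite initial segment does not affect
      convergence.\<close>
    have "convergent (\<lambda>k. f ((diagseq \<circ> ((+) (Suc i))) k) i)"
      by (rule diagseq_holds)
         (auto simp: o_def dest: convergent_subseq_convergent)
    then have "convergent (\<lambda>k. f (diagseq (k + Suc i)) i)"
      by (simp add: o_def add.commute)
    then show "convergent (\<lambda>k. f (diagseq k) i)"
      by (simp only: convergent_ignore_initial_segment[of "\<lambda>k. f (diagseq k) i"])
  qed
qed

lemma convergent_uniform_approx:
  fixes f :: "nat \<Rightarrow> real"
  assumes "\<And>e. e > 0 \<Longrightarrow> \<exists>g. convergent g \<and> (\<forall>k. \<bar>f k - g k\<bar> \<le> e)"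
  shows "convergent f"
proof (rule Cauchy_convergent, rule metric_CauchyI)
  fix e :: real assume "e > 0"
  then obtain g where g: "convergent g" "\<And>k. \<bar>f k - g k\<bar> \<le> e / 4"
    using assms[of "e / 4"] by auto
  obtain N where N: "\<And>m n. m \<ge> N \<Longrightarrow> n \<ge> N \<Longrightarrow> dist (g m) (g n) < e / 4"
    using metric_CauchyD[OF convergent_Cauchy[OF g(1)], of "e / 4"] \<open>e > 0\<close> by auto
  have "dist (f m) (f n) < e" if "m \<ge> N" "n \<ge> N" for m n
    using N[OF that] g(2)[of m] g(2)[of n] \<open>e > 0\<close> unfolding dist_real_def by linarith
  then show "\<exists>M. \<forall>m\<ge>M. \<forall>n\<ge>M. dist (f m) (f n) < e" by blast
qed

text \<open>Equicontinuity at the empty set makes convergence on a \<open>\<pi>\<close>-system propagate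
  through disjoint unions, hence to the generated \<open>\<sigma>\<close>-algebra.\<close>

lemma convergent_sigma_sets:
  fixes a :: "nat \<Rightarrow> 'a set \<Rightarrow> real"
  assumes G: "Int_stable G" "G \<subseteq> Pow \<Omega>"
    and conv: "\<And>A. A \<in> G \<Longrightarrow> convergent (\<lambda>k. a k A)" "convergent (\<lambda>k. a k \<Omega>)"
    and add: "\<And>k A B. A \<in> sigma_sets \<Omega> G \<Longrightarrow> B \<in> sigma_sets \<Omega> G \<Longrightarrow> A \<inter> B = {} \<Longrightarrow>
      a k (A \<union> B) = a k A + a k B"
    and equi: "\<And>A e. range A \<subseteq> sigma_sets \<Omega> G \<Longrightarrow> decseq A \<Longrightarrow> (\<Inter>i. A i) = {} \<Longrightarrow> e > 0 \<Longrightarrow>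
      \<exists>i::nat. \<forall>k. \<bar>a k (A i)\<bar> \<le> e"
    and "A \<in> sigma_sets \<Omega> G"
  shows "convergent (\<lambda>k. a k A)"
  using G assms(7)
proof (induction rule: sigma_sets_induct_disjoint)
  case (basic A)
  then show ?case by (rule conv)
next
  case empty
  have "a k {} = 0" for k using add[of "{}" "{}" k] by (simp add: sigma_sets.Empty)
  then show ?case by (simp add: convergent_const)
next
  case (compl A)
  have "A \<subseteq> \<Omega>" using sigma_sets_into_sp[OF G(2) compl(1)] .
  then have "a k (\<Omega> - A) = a k \<Omega> - a k A" for k
    using add[OF compl(1) sigma_sets.Compl[OF compl(1)], of k] by (simp add: Un_absorb1)
  then show ?case using convergent_diff[OF conv(2) compl(2)] by simp
next
  case (union A)
  interpret sigma_algebra \<Omega> "sigma_sets \<Omega> G" by (rule sigma_algebra_sigma_sets[OF G(2)])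
  \<comment> \<open>The tails decrease to the empty set, so equicontinuity bounds the remainder of
    the infinite union uniformly in \<open>k\<close>.\<close>
  define T where "T m = (\<Union>i\<in>{m..}. A i)" for m
  have A: "A i \<in> sigma_sets \<Omega> G" for i using union(2) by auto
  have T: "T m \<in> sigma_sets \<Omega> G" for m unfolding T_def using A by auto
  have split: "a k (\<Union>i. A i) = (\<Sum>i<m. a k (A i)) + a k (T m)" for k m
  proof (induction m)
    case 0
    then show ?case by (simp add: T_def)
  next
    case (Suc m)
    have "{m..} = insert m {Suc m..}" by auto
    then have "T m = A m \<union> T (Suc m)" unfolding T_def by simp
    moreover have "A m \<inter> T (Suc m) = {}"
    proof -
      have "A m \<inter> A i = {}" if "i \<ge> Suc m" for i
        using disjoint_family_onD[OF union(1), of m i] that by simp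
      then show ?thesis unfolding T_def by blast
    qed
    ultimately have "a k (T m) = a k (A m) + a k (T (Suc m))" using add A T by simp
    with Suc show ?case by simp
  qed
  show ?case
  proof (rule convergent_uniform_approx)
    fix e :: real assume "e > 0"
    have "decseq T" unfolding T_def decseq_def by (intro allI impI UN_mono) auto
    moreover have "(\<Inter>m. T m) = {}"
    proof -
      have False if x: "\<And>m. x \<in> T m" for x
      proof -
        from x[of 0] obtain i where i: "x \<in> A i" by (auto simp: T_def)
        from x[of "Suc i"] obtain j where j: "j > i" "x \<in> A j" by (auto simp: T_def Suc_le_eq)
        with i disjoint_family_onD[OF union(1), of i j] show False by auto
      qed
      then show ?thesis by auto
    qed
    ultimately obtain m where m: "\<And>k. \<bar>a k (T m)\<bar> \<le> e"
      using equi[of T e] T \<open>e > 0\<close> by auto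
    have "convergent (\<lambda>k. \<Sum>i<m. a k (A i))" by (intro convergent_sum union(3))
    then show "\<exists>g. convergent g \<and> (\<forall>k. \<bar>a k (\<Union>i. A i) - g k\<bar> \<le> e)"
      using m by (intro exI[of _ "\<lambda>k. \<Sum>i<m. a k (A i)"]) (simp add: split[of _ m])
  qed
qed

text \<open>Convergence against indicators extends by linearity to simple functions and, because
  \<open>F n\<close> is bounded by 1, to their \<open>L\<close>-integrable limits. The Radon-Nikodym
  derivative of \<open>N\<close> is one of these.\<close>

lemma convergent_integral_absolutely_continuous:
  fixes F :: "nat \<Rightarrow> 'a \<Rightarrow> real"
  assumes L: "prob_space L" and N: "prob_space N" "sets N = sets L" "absolutely_continuous L N"
    and F: "\<And>n. F n \<in> borel_measurable L" "\<And>n x. \<bar>F n x\<bar> \<le> 1"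
    and conv: "\<And>A. A \<in> sets L \<Longrightarrow> convergent (\<lambda>n. \<integral>x. indicator A x * F n x \<partial>L)"
  shows "convergent (\<lambda>n. \<integral>x. F n x \<partial>N)"
proof -
  interpret L: prob_space L by fact
  interpret N: prob_space N by fact
  obtain D where D: "D \<in> borel_measurable L" "AE x in L. RN_deriv L N x = ennreal (D x)" "\<And>x. 0 \<le> D x"
    using L.real_RN_deriv[OF N.finite_measure_axioms N(3,2)] by blast
  have "N = density L (RN_deriv L N)" using L.density_RN_deriv[OF N(3,2)] by simp
  also have "\<dots> = density L (\<lambda>x. ennreal (D x))"
    using D by (intro density_cong) auto
  finally have dens: "N = density L (\<lambda>x. ennreal (D x))" .
  have "(\<integral>\<^sup>+x. ennreal (D x) \<partial>L) = 1"
    using N.emeasure_space_1 D(1) sets_eq_imp_space_eq[OF N(2)]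
    by (subst (asm) dens) (simp add: emeasure_density cong: nn_integral_cong_simp)
  then have D_int: "integrable L D"
    using D by (intro integrableI_nonneg) auto
  have mult_int: "integrable L (\<lambda>x. f x * F n x)" if "integrable L f" for f :: "'a \<Rightarrow> real" and n
    using that F(2)[of n] F(1)[of n]
    by (intro Bochner_Integration.integrable_bound[OF that])
      (auto simp: abs_mult intro!: mult_left_le)
  have "convergent (\<lambda>n. \<integral>x. D x * F n x \<partial>L)"
    using D_int
  proof (induction rule: integrable_induct)
    case (base A c)
    have "(\<integral>x. indicator A x *\<^sub>R c * F n x \<partial>L) = c * (\<integral>x. indicator A x * F n x \<partial>L)" for n
      by (simp flip: integral_mult_right_zero add: ac_simps)
    then show ?case using conv[OF base(1)] by (auto intro: convergent_mult convergent_const)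
  next
    case (add f g)
    then show ?case
      using convergent_add[OF add(3,4)] by (simp add: distrib_right mult_int)
  next
    case (lim f s)
    show ?case
    proof (rule convergent_uniform_approx)
      fix e :: real assume "e > 0"
      \<comment> \<open>The induction rule provides approximants bounded by twice the absolute value
        of \<open>f\<close>, whence the dominating factor 3.\<close>
      have "(\<lambda>i. \<integral>x. \<bar>f x - s i x\<bar> \<partial>L) \<longlonglongrightarrow> (\<integral>x. 0 \<partial>L)"
      proof (rule integral_dominated_convergence[where w = "\<lambda>x. 3 * \<bar>f x\<bar>"])
        show "integrable L (\<lambda>x. 3 * \<bar>f x\<bar>)" using lim(4) by simp
        show "AE x in L. (\<lambda>i. \<bar>f x - s i x\<bar>) \<longlonglongrightarrow> 0"
        proof (rule AE_I2)
          fix x assume "x \<in> space L"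
          from tendsto_diff[OF tendsto_const lim(2)[OF this], of "f x"]
          show "(\<lambda>i. \<bar>f x - s i x\<bar>) \<longlonglongrightarrow> 0" by (auto intro: tendsto_rabs_zero)
        qed
        show "AE x in L. norm \<bar>f x - s i x\<bar> \<le> 3 * \<bar>f x\<bar>" for i
          using lim(3)[of _ i] by (intro AE_I2) (smt (verit) real_norm_def)
      qed (use borel_measurable_integrable[OF lim(1)] borel_measurable_integrable[OF lim(4)] in auto)
      then have "eventually (\<lambda>i. (\<integral>x. \<bar>f x - s i x\<bar> \<partial>L) < e) sequentially"
        using \<open>e > 0\<close> by (intro order_tendstoD) simp_all
      then obtain i where i: "(\<integral>x. \<bar>f x - s i x\<bar> \<partial>L) < e"
        by (auto simp: eventually_sequentially)
      have "\<bar>(\<integral>x. f x * F n x \<partial>L) - (\<integral>x. s i x * F n x \<partial>L)\<bar> \<le> e" for n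
      proof -
        have "\<bar>(\<integral>x. f x * F n x \<partial>L) - (\<integral>x. s i x * F n x \<partial>L)\<bar> = \<bar>\<integral>x. (f x - s i x) * F n x \<partial>L\<bar>"
          using lim by (simp add: mult_int left_diff_distrib)
        also have "\<dots> \<le> (\<integral>x. \<bar>(f x - s i x) * F n x\<bar> \<partial>L)" by (rule integral_abs_bound)
        also have "\<dots> \<le> (\<integral>x. \<bar>f x - s i x\<bar> \<partial>L)"
          using lim F(2)[of n] by (intro integral_mono integrable_abs mult_int)
            (auto simp: abs_mult intro!: mult_left_le)
        finally show ?thesis using i by simp
      qed
      then show "\<exists>g. convergent g \<and> (\<forall>n. \<bar>(\<integral>x. f x * F n x \<partial>L) - g n\<bar> \<le> e)"
        using lim(5) by blast
    qed
  qed
  moreover have "(\<integral>x. F n x \<partial>N) = (\<integral>x. D x * F n x \<partial>L)" for n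
    unfolding dens using D F by (simp add: integral_real_density)
  ultimately show ?thesis by simp
qed

section \<open>Compactness of the squared strong Feller operator\<close>

text \<open>Average one point at a time: for fixed \<open>z\<close> the value at \<open>y\<close>
  lies within \<open>e\<close> of \<open>F z\<close>; averaging this over \<open>z\<close> under
  \<open>\<nu> x\<close> gives the claim.\<close>

lemma markov_op_osc_le:
  assumes "markov_kernel \<nu>" "bounded_measurable F" "\<And>x y. \<bar>F x - F y\<bar> \<le> e"
  shows "\<bar>markov_op \<nu> F x - markov_op \<nu> F y\<bar> \<le> e"
proof -
  have *: "F z - e \<le> F w" "F w \<le> F z + e" for z w
    using assms(3)[of z w] by auto
  have "F z - e \<le> markov_op \<nu> F y" "markov_op \<nu> F y \<le> F z + e" for z
    using markov_op_bounds[OF assms(1,2), of "F z - e" "F z + e" y] * by auto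
  then have "markov_op \<nu> F y - e \<le> F z" "F z \<le> markov_op \<nu> F y + e" for z
    by (auto simp: algebra_simps)
  from markov_op_bounds[OF assms(1,2) this, of x] show ?thesis by auto
qed

text \<open>For a given partition, the test function equal on each cell to the sign of the signed
  measure there attains the sum of absolute values.\<close>

lemma tv_norm_diff_measure_le:
  assumes M: "prob_space M" "sets M = sets borel" and N: "prob_space N" "sets N = sets borel"
    and le: "\<And>F. bounded_measurable F \<Longrightarrow> (\<And>x. \<bar>F x\<bar> \<le> 1) \<Longrightarrow> (\<integral>x. F x \<partial>M) - (\<integral>x. F x \<partial>N) \<le> c"
  shows "tv_norm (diff_measure_fun M N) \<le> ennreal c"
  unfolding tv_norm_def
proof (rule SUP_least)
  fix \<A> :: "'a set set"
  assume "\<A> \<in> {\<A>. finite \<A> \<and> partition_on UNIV \<A> \<and> \<A> \<subseteq> sets borel}"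
  then have \<A>: "finite \<A>" "partition_on UNIV \<A>" "\<And>A. A \<in> \<A> \<Longrightarrow> A \<in> sets borel" by auto
  define m where "m = diff_measure_fun M N"
  define F where "F x = (\<Sum>A\<in>\<A>. sgn (m A) * indicator A x)" for x
  have bm: "bounded_measurable F"
    unfolding F_def using \<A> by (intro bounded_measurable_intros) auto
  have "\<bar>F x\<bar> \<le> 1" for x
  proof -
    obtain A where A: "A \<in> \<A>" "x \<in> A" using \<A>(2) by (auto simp: partition_on_def)
    then have "F x = (\<Sum>B\<in>\<A>. if B = A then sgn (m A) else 0)"
      unfolding F_def using \<A>(2)
      by (intro sum.cong) (auto simp: partition_on_def disjoint_def indicator_def)
    then show ?thesis using \<A>(1) A by (simp add: abs_sgn_eq)
  qed
  from le[OF bm this] have "(\<integral>x. F x \<partial>M) - (\<integral>x. F x \<partial>N) \<le> c" .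
  moreover have "(\<integral>x. F x \<partial>Q) = (\<Sum>A\<in>\<A>. sgn (m A) * measure Q A)"
    if "prob_space Q" "sets Q = sets borel" for Q
  proof -
    have "space Q = UNIV" using sets_eq_imp_space_eq[OF that(2)] by simp
    then show ?thesis unfolding F_def
      using \<A> that(2) integrable_bounded_measurable[OF that bounded_measurable_indicator]
      by (subst Bochner_Integration.integral_sum) auto
  qed
  ultimately have "(\<Sum>A\<in>\<A>. sgn (m A) * m A) \<le> c"
    using M N by (simp add: m_def diff_measure_fun_def sum_subtractf right_diff_distrib)
  then have "(\<Sum>A\<in>\<A>. \<bar>m A\<bar>) \<le> c" by (simp add: abs_sgn mult.commute)
  then show "(\<Sum>A\<in>\<A>. ennreal \<bar>diff_measure_fun M N A\<bar>) \<le> ennreal c"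
    by (simp add: m_def ennreal_leI)
qed

text \<open>After \<open>k\<close> halvings, \<open>t\<close> may extend into the next block of
  length \<open>N\<close>; paying for that block costs one factor 2.\<close>

lemma half_power_le_exp:
  assumes "N > 0" "t \<le> real (Suc k) * N"
  shows "2 * (1/2) ^ k \<le> 4 * exp (- (ln 2 / N) * t)"
proof -
  have "ln 2 / N * t \<le> ln 2 / N * (real (Suc k) * N)"
    using assms by (intro mult_left_mono) auto
  also have "\<dots> = real (Suc k) * ln 2" using assms(1) by simp
  finally have "exp (- (real (Suc k) * ln 2)) \<le> exp (- (ln 2 / N) * t)" by simp
  moreover have "(1/2) ^ Suc k = exp (- (real (Suc k) * ln 2))"
    by (subst exp_minus, subst exp_of_nat_mult) (simp add: power_one_over inverse_eq_divide)
  ultimately have "(1/2) ^ Suc k \<le> exp (- (ln 2 / N) * t)" by (simp only:)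
  then show ?thesis by simp
qed

section \<open>Iterates of a strong Feller operator\<close>

locale compact_strong_feller =
  fixes \<nu> :: "'a::metric_space \<Rightarrow> 'a measure"
  assumes compact_UNIV: "compact (UNIV :: 'a set)"
    and markov: "markov_kernel \<nu>"
    and feller: "strong_feller \<nu>"
begin

abbreviation P where "P \<equiv> markov_op \<nu>"

lemma continuous_P: "bounded_measurable F \<Longrightarrow> continuous_on UNIV (P F)"
  using feller by (simp add: strong_feller_def)

lemma bounded_measurable_P: "bounded_measurable F \<Longrightarrow> bounded_measurable (P F)"
  by (rule bounded_measurable_markov_op[OF markov])

lemma markov_pow: "markov_kernel (kernel_pow \<nu> n)"
  by (rule markov_kernel_kernel_pow[OF markov])

lemma funpow_P: "bounded_measurable F \<Longrightarrow> (P ^^ n) F = markov_op (kernel_pow \<nu> n) F"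
  by (rule funpow_markov_op[OF markov])

lemma bounded_measurable_funpow: "bounded_measurable F \<Longrightarrow> bounded_measurable ((P ^^ n) F)"
  by (simp add: funpow_P bounded_measurable_markov_op[OF markov_pow])

lemma funpow_contract:
  assumes "bounded_measurable F" "bounded_measurable G" "\<And>x. \<bar>F x - G x\<bar> \<le> e"
  shows "\<bar>(P ^^ n) F y - (P ^^ n) G y\<bar> \<le> e"
  using assms by (simp add: funpow_P markov_op_contract[OF markov_pow])

lemma funpow_abs_le:
  assumes "bounded_measurable F" "\<And>x. \<bar>F x\<bar> \<le> b"
  shows "\<bar>(P ^^ n) F y\<bar> \<le> b"
  using assms by (simp add: funpow_P markov_op_abs_le[OF markov_pow])

lemma funpow_osc_le:
  assumes "bounded_measurable F" "\<And>x y. \<bar>F x - F y\<bar> \<le> e"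
  shows "\<bar>(P ^^ n) F x - (P ^^ n) F y\<bar> \<le> e"
  using assms by (simp add: funpow_P markov_op_osc_le[OF markov_pow])

lemma funpow_osc_mono:
  assumes "bounded_measurable F" "\<And>x y. \<bar>(P ^^ m) F x - (P ^^ m) F y\<bar> \<le> e" "m \<le> n"
  shows "\<bar>(P ^^ n) F x - (P ^^ n) F y\<bar> \<le> e"
proof -
  have "(P ^^ n) F = (P ^^ (n - m)) ((P ^^ m) F)"
    using assms(3) by (metis add_diff_inverse_nat comp_apply funpow_add add.commute not_less)
  then show ?thesis
    using funpow_osc_le[OF bounded_measurable_funpow[OF assms(1)] assms(2)] by simp
qed

lemma continuous_funpow_Suc: "bounded_measurable F \<Longrightarrow> continuous_on UNIV ((P ^^ Suc n) F)"
  by (simp add: continuous_P bounded_measurable_funpow)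

text \<open>The reference measure is a mixture of the \<open>\<nu> x\<^sub>i\<close> with \<open>x\<^sub>i\<close> dense: by the strong Feller
  property, \<open>\<nu> x A\<close> vanishes for all \<open>x\<close> once it vanishes on a dense set.\<close>

lemma dominating_measure:
  obtains L where "prob_space L" "sets L = sets borel" "\<And>x. absolutely_continuous L (\<nu> x)"
proof -
  obtain B :: "'a set set" where B: "countable B" "topological_basis B"
    using compact_metric_countable_basis[OF compact_UNIV] .
  obtain X :: "nat \<Rightarrow> 'a" where X: "\<And>U. open U \<Longrightarrow> U \<noteq> {} \<Longrightarrow> \<exists>i. X i \<in> U"
    using countable_basis_dense_sequence[OF B] by blast
  define p where "p = measure_pmf (geometric_pmf (1/2))"
  define L where "L = p \<bind> (\<lambda>i. \<nu> (X i))"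
  have meas: "(\<lambda>i. \<nu> (X i)) \<in> p \<rightarrow>\<^sub>M subprob_algebra borel"
    using measurable_space[OF markov_kernelD(4)[OF markov]] by (auto simp: p_def)
  have p: "prob_space p" "space p = UNIV" unfolding p_def by (auto simp: prob_space_measure_pmf)
  have L: "sets L = sets borel" "prob_space L"
  proof -
    show "sets L = sets borel"
      unfolding L_def by (rule sets_bind) (auto simp: markov_kernelD[OF markov] p)
    interpret p: prob_space p by fact
    show "prob_space L" unfolding L_def
      by (rule p.prob_space_bind[where S = borel])
        (use meas markov_kernelD[OF markov] in auto)
  qed
  have "absolutely_continuous L (\<nu> x)" for x
    unfolding absolutely_continuous_def
  proof
    fix A assume "A \<in> null_sets L"
    then have A: "A \<in> sets borel" "emeasure L A = 0" using L by auto
    have "(\<integral>\<^sup>+i. emeasure (\<nu> (X i)) A \<partial>p) = 0"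
      using A(2) unfolding L_def by (subst (asm) emeasure_bind[OF _ meas A(1)]) (auto simp: p)
    then have "AE i in p. emeasure (\<nu> (X i)) A = 0"
      by (subst (asm) nn_integral_0_iff_AE) (auto simp: p_def)
    then have zero: "emeasure (\<nu> (X i)) A = 0" for i
      unfolding p_def by (simp add: AE_measure_pmf_iff set_pmf_geometric)
    have cont: "continuous_on UNIV (\<lambda>x. measure (\<nu> x) A)"
      using continuous_P[OF bounded_measurable_indicator[OF A(1)]]
      by (simp add: markov_op_indicator[OF markov A(1)] cong: continuous_on_cong)
    have "{x. measure (\<nu> x) A \<noteq> 0} = {}"
    proof (rule ccontr)
      assume "{x. measure (\<nu> x) A \<noteq> 0} \<noteq> {}"
      moreover have "open {x. measure (\<nu> x) A \<noteq> 0}"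
        using cont by (intro open_Collect_neq continuous_on_const)
      ultimately obtain i where "measure (\<nu> (X i)) A \<noteq> 0" using X by blast
      then show False using zero by (simp add: measure_def)
    qed
    moreover have "finite_measure (\<nu> x)"
      using markov_kernelD(1)[OF markov] by (rule prob_space.finite_measure)
    ultimately have "emeasure (\<nu> x) A = 0" by (auto simp: finite_measure.emeasure_eq_measure)
    with A show "A \<in> null_sets (\<nu> x)" by (auto simp: markov_kernelD[OF markov])
  qed
  with L show ?thesis using that by blast
qed

text \<open>The \<open>D n\<close> are only measurable, so Dini's theorem does not apply to them.
  \<open>P\<close> makes them continuous, keeps them decreasing, and by dominated convergence keeps
  the limit 0.\<close>

lemma P_uniform_null:
  assumes bm: "\<And>n. bounded_measurable (D n)" and "\<And>n x. \<bar>D n x\<bar> \<le> B"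
    and "\<And>n x. D (Suc n) x \<le> D n x" "\<And>x. (\<lambda>n. D n x) \<longlonglongrightarrow> 0" and "e > 0"
  obtains N where "\<And>n x. n \<ge> N \<Longrightarrow> P (D n) x < e"
proof (rule dini[OF compact_UNIV, of "\<lambda>n. P (D n)"])
  show "continuous_on UNIV (P (D n))" for n by (rule continuous_P[OF bm])
  show "P (D (Suc n)) x \<le> P (D n) x" for n x
    by (rule markov_op_mono[OF markov bm bm assms(3)])
  have "(\<lambda>n. P (D n) x) \<longlonglongrightarrow> P (\<lambda>_. 0) x" for x
    using assms bounded_measurable_measurable[OF bm] by (intro markov_op_tendsto[OF markov]) auto
  then show "(\<lambda>n. P (D n) x) \<longlonglongrightarrow> 0" for x by (simp add: markov_op_const[OF markov])
qed (use assms(5) that in auto)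

text \<open>Weak-star convergence in \<open>L\<^sup>\<infinity>\<close> of the dominating measure becomes pointwise convergence
  under \<open>P\<close>, and a second application of \<open>P\<close> upgrades this to uniform convergence by Dini's theorem.\<close>

lemma P_P_sequentially_compact:
  fixes F :: "nat \<Rightarrow> 'a \<Rightarrow> real"
  assumes F: "\<And>n. bounded_measurable (F n)" "\<And>n x. \<bar>F n x\<bar> \<le> 1"
  obtains r h where "strict_mono r" "continuous_on UNIV h" "\<And>x. \<bar>h x\<bar> \<le> 1"
    "uniform_limit UNIV (\<lambda>k. P (P (F (r k)))) h sequentially"
proof -
  obtain B :: "'a set set" where B: "countable B" "topological_basis B"
    using compact_metric_countable_basis[OF compact_UNIV] .
  obtain G :: "nat \<Rightarrow> 'a set" where G: "Int_stable (range G)" "sets borel = sigma_sets UNIV (range G)"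
    using countable_borel_generator[OF B] .
  obtain L where L: "prob_space L" "sets L = sets borel" "\<And>x. absolutely_continuous L (\<nu> x)"
    using dominating_measure by blast
  interpret L: prob_space L by fact
  have spaceL: "space L = UNIV" using sets_eq_imp_space_eq[OF L(2)] by simp
  note intL = integrable_bounded_measurable[OF L(1,2)]
  define a where "a n A = (\<integral>x. indicator A x * F n x \<partial>L)" for n A
  have a_int: "integrable L (\<lambda>x. indicator A x * F n x)" if "A \<in> sets borel" for A n
    using F that by (intro intL bounded_measurable_intros)
  have a_le: "\<bar>a n A\<bar> \<le> measure L A" if A: "A \<in> sets borel" for n A
  proof -
    have "\<bar>a n A\<bar> \<le> (\<integral>x. \<bar>indicator A x * F n x\<bar> \<partial>L)" unfolding a_def by (rule integral_abs_bound)
    also have "\<dots> \<le> (\<integral>x. indicator A x \<partial>L)"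
      using F A by (intro integral_mono intL bounded_measurable_intros) (auto simp: indicator_def)
    also have "\<dots> = measure L A" using A by (simp add: L(2) spaceL)
    finally show ?thesis .
  qed
  have Gs: "G i \<in> sets borel" for i unfolding G(2) by auto
  \<comment> \<open>Coordinate 0 follows the whole space, which is needed for complements; the
    others follow the generators.\<close>
  define f where "f n i = (case i of 0 \<Rightarrow> a n UNIV | Suc j \<Rightarrow> a n (G j))" for n i
  have "\<bar>f n i\<bar> \<le> 1" for n i
    using a_le[of UNIV n] a_le[OF Gs, of n] L.prob_le_1 unfolding f_def
    by (auto split: nat.split intro: order_trans)
  then obtain r where r: "strict_mono r" "\<And>i. convergent (\<lambda>k. f (r k) i)"
    using bounded_diagonal_subsequence[of f 1] by blast
  have conv: "convergent (\<lambda>k. a (r k) A)" if "A \<in> sets borel" for A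
  proof (rule convergent_sigma_sets[where a = "\<lambda>k. a (r k)" and G = "range G" and \<Omega> = UNIV])
    show "convergent (\<lambda>k. a (r k) UNIV)" using r(2)[of 0] by (simp add: f_def)
    show "convergent (\<lambda>k. a (r k) A)" if "A \<in> range G" for A
      using r(2)[of "Suc _"] that by (auto simp: f_def)
    show "a (r k) (A \<union> B) = a (r k) A + a (r k) B"
      if "A \<in> sigma_sets UNIV (range G)" "B \<in> sigma_sets UNIV (range G)" "A \<inter> B = {}" for k A B
    proof -
      have "(\<lambda>x. indicator (A \<union> B) x * F (r k) x)
          = (\<lambda>x. indicator A x * F (r k) x + indicator B x * F (r k) x)"
        using that(3) by (intro ext) (auto split: split_indicator)
      then show ?thesis
        using that a_int unfolding a_def by (simp add: G(2))
    qed
    show "\<exists>i. \<forall>k. \<bar>a (r k) (A i)\<bar> \<le> e"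
      if A: "range A \<subseteq> sigma_sets UNIV (range G)" "decseq A" "(\<Inter>i. A i) = {}" "e > 0" for A e
    proof -
      \<comment> \<open>All \<open>a n\<close> are dominated by \<open>L\<close>, so one index
        serves every \<open>k\<close>.\<close>
      have "(\<lambda>i. measure L (A i)) \<longlonglongrightarrow> measure L (\<Inter>i. A i)"
        using A by (intro L.finite_Lim_measure_decseq) (auto simp: L(2) G(2))
      then have "eventually (\<lambda>i. measure L (A i) < e) sequentially"
        using A(3,4) by (intro order_tendstoD) auto
      then obtain i where "measure L (A i) < e" by (auto simp: eventually_sequentially)
      moreover have "A i \<in> sets borel" using A(1) by (auto simp: G(2))
      ultimately have "\<bar>a (r k) (A i)\<bar> \<le> e" for k using a_le[of "A i" "r k"] by linarith
      then show ?thesis by blast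
    qed
  qed (use that G in auto)
  have "convergent (\<lambda>k. P (F (r k)) x)" for x
    unfolding markov_op_def
  proof (rule convergent_integral_absolutely_continuous[OF L(1) markov_kernelD(1)[OF markov] _ L(3)])
    show "F (r n) \<in> borel_measurable L" for n
      using bounded_measurable_measurable[OF F(1)] L(2) by (simp cong: measurable_cong_sets)
  qed (use conv F(2) in \<open>auto simp: markov_kernelD[OF markov] L(2) a_def\<close>)
  then obtain u where u: "\<And>x. (\<lambda>k. P (F (r k)) x) \<longlonglongrightarrow> u x"
    unfolding convergent_def by metis
  have PF: "bounded_measurable (P (F n))" "\<bar>P (F n) x\<bar> \<le> 1" for n x
    using F by (auto intro: bounded_measurable_P markov_op_abs_le[OF markov])
  have u_le: "\<bar>u x\<bar> \<le> 1" for x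
    by (rule LIMSEQ_le_const2[OF tendsto_rabs[OF u]]) (use PF(2) in auto)
  have u_bm: "bounded_measurable u"
    using borel_measurable_LIMSEQ_real[of borel "\<lambda>k. P (F (r k))", OF u] u_le
      bounded_measurable_measurable[OF PF(1)]
    by (intro bounded_measurableI) auto
  \<comment> \<open>The errors need not decrease, as Dini's theorem requires; their tail suprema do,
    and they still tend to 0.\<close>
  define D where "D n x = (SUP k\<in>{n..}. \<bar>P (F (r k)) x - u x\<bar>)" for n x
  have le2: "\<bar>P (F (r k)) x - u x\<bar> \<le> 2" for k x
    using PF(2)[of "r k" x] u_le[of x] by linarith
  have bdd: "bdd_above ((\<lambda>k. \<bar>P (F (r k)) x - u x\<bar>) ` {n..})" for n x
    using le2 by (intro bdd_aboveI2)
  have D_ge: "\<bar>P (F (r k)) x - u x\<bar> \<le> D n x" if "k \<ge> n" for k n x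
    unfolding D_def using that bdd by (intro cSUP_upper) auto
  have D_dec: "D (Suc n) x \<le> D n x" for n x
    unfolding D_def using bdd by (intro cSUP_subset_mono) auto
  have D_bd: "\<bar>D n x\<bar> \<le> 2" for n x
  proof -
    have "D n x \<le> 2" unfolding D_def using le2 by (intro cSUP_least) auto
    moreover have "0 \<le> D n x" using D_ge[of n n x] by linarith
    ultimately show ?thesis by simp
  qed
  have D_bm: "bounded_measurable (D n)" for n
  proof (rule bounded_measurableI[OF _ D_bd])
    show "D n \<in> borel_measurable borel"
      unfolding D_def using bdd bounded_measurable_measurable[OF PF(1)] bounded_measurable_measurable[OF u_bm]
      by (intro borel_measurable_cSUP) auto
  qed
  have D_lim: "(\<lambda>n. D n x) \<longlonglongrightarrow> 0" for x
  proof (rule LIMSEQ_I)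
    fix e :: real assume "e > 0"
    then obtain K where K: "\<And>k. k \<ge> K \<Longrightarrow> \<bar>P (F (r k)) x - u x\<bar> < e / 2"
      using LIMSEQ_D[OF u, of "e / 2" x] by auto
    have "norm (D n x - 0) < e" if "n \<ge> K" for n
    proof -
      have "D n x \<le> e / 2" unfolding D_def using K that by (intro cSUP_least) (auto intro: less_imp_le)
      moreover have "0 \<le> D n x" using D_ge[of n n x] by linarith
      ultimately show ?thesis using \<open>e > 0\<close> by simp
    qed
    then show "\<exists>K. \<forall>n\<ge>K. norm (D n x - 0) < e" by blast
  qed
  show ?thesis
  proof (rule that[OF r(1)])
    show "continuous_on UNIV (P u)" by (rule continuous_P[OF u_bm])
    show "\<bar>P u x\<bar> \<le> 1" for x by (rule markov_op_abs_le[OF markov u_bm u_le])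
    show "uniform_limit UNIV (\<lambda>k. P (P (F (r k)))) (P u) sequentially"
      unfolding uniform_limit_sequentially_iff
    proof (intro allI impI)
      fix e :: real assume "e > 0"
      obtain N where N: "\<And>n x. n \<ge> N \<Longrightarrow> P (D n) x < e"
        using P_uniform_null[of D 2, OF D_bm D_bd D_dec D_lim \<open>e > 0\<close>] by blast
      have "dist (P (P (F (r k))) x) (P u x) < e" if "k \<ge> N" for k x
      proof -
        let ?d = "\<lambda>x. P (F (r k)) x - u x"
        have d: "?d y \<le> D k y" "- ?d y \<le> D k y" for y
          using D_ge[of k k y] by (auto simp: abs_le_iff)
        have "P ?d x \<le> P (D k) x" "P (\<lambda>x. - ?d x) x \<le> P (D k) x"
          using d bounded_measurable_cmult[OF bounded_measurable_diff[OF PF(1) u_bm], of "-1"]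
          by (auto intro!: markov_op_mono[OF markov] D_bm bounded_measurable_diff PF u_bm)
        moreover have "P (\<lambda>x. - ?d x) x = - P ?d x" using markov_op_cmult[of \<nu> "-1" ?d] by simp
        moreover have "P ?d x = P (P (F (r k))) x - P u x"
          by (simp add: markov_op_diff[OF markov PF(1) u_bm])
        ultimately show ?thesis using N[OF that, of x] by (simp add: dist_real_def abs_less_iff)
      qed
      then show "\<exists>N. \<forall>k\<ge>N. \<forall>x\<in>UNIV. dist (P (P (F (r k))) x) (P u x) < e" by blast
    qed
  qed
qed

text \<open>Constant limit points flatten the orbit of each continuous function
  (\<open>single\<close>). If no exponent served the whole unit ball, a subsequence of the two-step
  images of the counterexamples would approach one continuous \<open>h\<close>, and the flattening
  of \<open>h\<close> would contradict their oscillation.\<close>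

lemma uniform_mixing:
  assumes const: "\<And>H G r x y. continuous_on UNIV H \<Longrightarrow> strict_mono r \<Longrightarrow> continuous_on UNIV G \<Longrightarrow>
      uniform_limit UNIV (\<lambda>k. (P ^^ r k) H) G sequentially \<Longrightarrow> G x = G y"
  obtains N where "\<And>F x y. bounded_measurable F \<Longrightarrow> (\<And>x. \<bar>F x\<bar> \<le> 1) \<Longrightarrow>
      \<bar>(P ^^ N) F x - (P ^^ N) F y\<bar> \<le> 1/2"
proof -
  have single: "\<exists>N. \<forall>n\<ge>N. \<forall>x y. \<bar>(P ^^ n) H x - (P ^^ n) H y\<bar> \<le> e"
    if H: "continuous_on UNIV H" "\<And>x. \<bar>H x\<bar> \<le> 1" and "e > 0" for H e
  proof -
    have bm: "bounded_measurable H" by (rule bounded_measurable_continuous[OF compact_UNIV H(1)])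
    obtain r h where r: "strict_mono r" "continuous_on UNIV h" "\<And>x. \<bar>h x\<bar> \<le> 1"
      "uniform_limit UNIV (\<lambda>k. P (P ((P ^^ r k) H))) h sequentially"
      using P_P_sequentially_compact[of "\<lambda>n. (P ^^ n) H"] bounded_measurable_funpow[OF bm]
        funpow_abs_le[OF bm H(2)] by blast
    have "h x = h y" for x y
    proof (rule const[OF H(1) _ r(2)])
      show "strict_mono (\<lambda>k. Suc (Suc (r k)))" using r(1) by (auto simp: strict_mono_def)
    qed (use r(4) in simp)
    then have hc: "h y = h x" for x y by blast
    obtain k where k: "\<And>x. dist (P (P ((P ^^ r k) H)) x) (h x) < e / 2"
      using r(4) \<open>e > 0\<close> unfolding uniform_limit_sequentially_iff by (meson UNIV_I half_gt_zero order_refl)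
    have "\<bar>(P ^^ Suc (Suc (r k))) H x - (P ^^ Suc (Suc (r k))) H y\<bar> \<le> e" for x y
      using dist_triangle_half_l[OF k[of x], of "P (P ((P ^^ r k) H)) y"] k[of y] hc[of y x]
      by (simp add: dist_real_def less_imp_le)
    then show ?thesis using funpow_osc_mono[OF bm] by blast
  qed
  show ?thesis
  proof (rule ccontr)
    assume contr: "\<not> thesis"
    have "\<exists>F. bounded_measurable F \<and> (\<forall>x. \<bar>F x\<bar> \<le> 1) \<and>
        (\<exists>x y. \<not> \<bar>(P ^^ n) F x - (P ^^ n) F y\<bar> \<le> 1/2)" for n
    proof (rule ccontr)
      assume "\<not> ?thesis"
      then have "\<bar>(P ^^ n) F x - (P ^^ n) F y\<bar> \<le> 1/2"
        if "bounded_measurable F" "\<And>x. \<bar>F x\<bar> \<le> 1" for F x y using that by blast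
      from that[OF this] contr show False by blast
    qed
    then obtain F where F: "\<And>n. bounded_measurable (F n)" "\<And>n x. \<bar>F n x\<bar> \<le> 1"
      "\<And>n. \<exists>x y. \<not> \<bar>(P ^^ n) (F n) x - (P ^^ n) (F n) y\<bar> \<le> 1/2"
      by metis
    obtain r h where r: "strict_mono r" "continuous_on UNIV h" "\<And>x. \<bar>h x\<bar> \<le> 1"
      "uniform_limit UNIV (\<lambda>k. P (P (F (r k)))) h sequentially"
      by (rule P_P_sequentially_compact[of F, OF F(1,2)]) blast
    have hbm: "bounded_measurable h" by (rule bounded_measurable_continuous[OF compact_UNIV r(2)])
    obtain N where N: "\<And>n x y. n \<ge> N \<Longrightarrow> \<bar>(P ^^ n) h x - (P ^^ n) h y\<bar> \<le> 1/4"
      using single[OF r(2,3), of "1/4"] by auto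
    obtain K where K: "\<And>k x. k \<ge> K \<Longrightarrow> dist (P (P (F (r k))) x) (h x) < 1/8"
      using r(4)[unfolded uniform_limit_sequentially_iff, rule_format, of "1/8"]
      by (simp, blast)
    \<comment> \<open>Two of the \<open>r k\<close> steps are spent on reaching the neighbourhood of
      \<open>h\<close>, leaving at least \<open>N\<close>. The errors add up to 1/8 + 1/4 + 1/8 =
      1/2.\<close>
    define k where "k = max K (N + 2)"
    have k: "k \<ge> K" "r k \<ge> N + 2"
      using seq_suble[OF r(1), of k] by (auto simp: k_def)
    define n where "n = r k - 2"
    have n: "n \<ge> N" "r k = n + 2" using k(2) by (auto simp: n_def)
    have eq: "(P ^^ r k) (F (r k)) = (P ^^ n) (P (P (F (r k))))"
      unfolding n(2) funpow_add by (simp add: numeral_2_eq_2)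
    have close: "\<bar>(P ^^ n) (P (P (F (r k)))) x - (P ^^ n) h x\<bar> \<le> 1/8" for x
      using K[OF k(1)] by (intro funpow_contract bounded_measurable_P F hbm)
        (auto simp: dist_real_def intro: less_imp_le)
    have "\<bar>(P ^^ r k) (F (r k)) x - (P ^^ r k) (F (r k)) y\<bar> \<le> 1/2" for x y
      using N[OF n(1), of x y] close[of x] close[of y] unfolding eq by linarith
    with F(3)[of "r k"] show False by blast
  qed
qed

text \<open>Subtracting a value and rescaling puts any function of oscillation at most
  \<open>e\<close> into the unit ball, so the bound 1/2 becomes a contraction of the oscillation
  that can be iterated.\<close>

lemma geometric_mixing:
  assumes "\<And>H G r x y. continuous_on UNIV H \<Longrightarrow> strict_mono r \<Longrightarrow> continuous_on UNIV G \<Longrightarrow>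
      uniform_limit UNIV (\<lambda>k. (P ^^ r k) H) G sequentially \<Longrightarrow> G x = G y"
  obtains N where "N > 0" "\<And>k (F :: 'a \<Rightarrow> real) x y. bounded_measurable F \<Longrightarrow> (\<And>x. \<bar>F x\<bar> \<le> 1) \<Longrightarrow>
      \<bar>(P ^^ (k * N)) F x - (P ^^ (k * N)) F y\<bar> \<le> 2 * (1/2) ^ k"
proof -
  obtain N0 where N0: "\<And>F x y. bounded_measurable F \<Longrightarrow> (\<And>x. \<bar>F x\<bar> \<le> 1) \<Longrightarrow>
      \<bar>(P ^^ N0) F x - (P ^^ N0) F y\<bar> \<le> 1/2"
    using uniform_mixing assms by blast
  \<comment> \<open>The successor makes the block length positive; a further step cannot increase
    the oscillation.\<close>
  define N where "N = Suc N0"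
  have half: "\<bar>(P ^^ N) F x - (P ^^ N) F y\<bar> \<le> e / 2"
    if F: "bounded_measurable F" "\<And>x y. \<bar>F x - F y\<bar> \<le> e" and "e > 0" for F e x y
  proof -
    define z :: 'a where "z = undefined"
    define G where "G x = (1 / e) * (F x - F z)" for x
    have G: "bounded_measurable G" unfolding G_def by (intro bounded_measurable_intros F)
    have "\<bar>G x\<bar> \<le> 1" for x unfolding G_def using F(2)[of x z] \<open>e > 0\<close> by (simp add: abs_mult)
    from funpow_osc_mono[OF G N0[OF G this], of N x y]
    have "\<bar>(P ^^ N) G x - (P ^^ N) G y\<bar> \<le> 1/2" by (simp add: N_def)
    moreover have "(P ^^ N) G = (\<lambda>x. (1 / e) * ((P ^^ N) F x - F z))"
      using funpow_P[OF G] unfolding G_def markov_op_cmult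
      by (simp add: markov_op_diff[OF markov_pow] markov_op_const[OF markov_pow] F
          bounded_measurable_const funpow_P)
    ultimately have "\<bar>(1 / e) * ((P ^^ N) F x - (P ^^ N) F y)\<bar> \<le> 1/2"
      by (simp add: algebra_simps diff_divide_distrib)
    then show ?thesis using \<open>e > 0\<close> by (simp add: abs_mult field_simps)
  qed
  show ?thesis
  proof (rule that[of N])
    show "N > 0" by (simp add: N_def)
    fix k and F :: "'a \<Rightarrow> real" and x y assume F: "bounded_measurable F" "\<And>x. \<bar>F x\<bar> \<le> 1"
    show "\<bar>(P ^^ (k * N)) F x - (P ^^ (k * N)) F y\<bar> \<le> 2 * (1/2) ^ k"
    proof (induction k arbitrary: x y)
      case 0
      then show ?case using F(2)[of x] F(2)[of y] by simp
    next
      case (Suc k)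
      have "(P ^^ (Suc k * N)) F = (P ^^ N) ((P ^^ (k * N)) F)" by (simp add: funpow_add)
      then show ?case using half[OF bounded_measurable_funpow[OF F(1)] Suc] by simp
    qed
  qed
qed

end

section \<open>Invariant measures as limits of averages\<close>

lemma prob_space_markov_adjoint:
  assumes "markov_kernel \<kappa>" "prob_space M" "sets M = sets borel"
  shows "prob_space (markov_adjoint \<kappa> M)" "sets (markov_adjoint \<kappa> M) = sets borel"
proof -
  have M: "M \<in> space (prob_algebra borel)" using assms(2,3) by (simp add: space_prob_algebra)
  show "prob_space (markov_adjoint \<kappa> M)" "sets (markov_adjoint \<kappa> M) = sets borel"
    unfolding markov_adjoint_def using assms(1)[unfolded markov_kernel_def]
    by (rule prob_space_bind'[OF M] sets_bind'[OF M])+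
qed

lemma invariant_prob_integral:
  assumes "markov_kernel \<kappa>" "invariant_prob \<kappa> M" "bounded_measurable F"
  shows "(\<integral>x. markov_op \<kappa> F x \<partial>M) = (\<integral>x. F x \<partial>M)"
  using integral_markov_adjoint[OF assms(1) _ _ assms(3), of M] assms(2)
  by (simp add: invariant_prob_def)

lemma invariant_probI:
  assumes \<kappa>: "markov_kernel \<kappa>" and M: "prob_space M" "sets M = sets borel"
    and inv: "\<And>A. A \<in> sets borel \<Longrightarrow> (\<integral>x. markov_op \<kappa> (indicator A) x \<partial>M) = measure M A"
  shows "invariant_prob \<kappa> M"
  unfolding invariant_prob_def
proof (intro conjI M measure_eqI)
  interpret M: prob_space M by fact
  interpret N: prob_space "markov_adjoint \<kappa> M" by (rule prob_space_markov_adjoint[OF \<kappa> M])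
  note sets = prob_space_markov_adjoint(2)[OF \<kappa> M]
  show "sets (markov_adjoint \<kappa> M) = sets M" by (simp add: sets M)
  fix A assume "A \<in> sets (markov_adjoint \<kappa> M)"
  then have A: "A \<in> sets borel" by (simp add: sets)
  have "measure (markov_adjoint \<kappa> M) A = (\<integral>x. indicator A x \<partial>markov_adjoint \<kappa> M)"
    using A sets sets_eq_imp_space_eq[OF sets] by simp
  also have "\<dots> = (\<integral>x. markov_op \<kappa> (indicator A) x \<partial>M)"
    by (rule integral_markov_adjoint[OF \<kappa> M bounded_measurable_indicator[OF A]])
  also have "\<dots> = measure M A" by (rule inv[OF A])
  finally show "emeasure (markov_adjoint \<kappa> M) A = emeasure M A"
    by (simp add: N.emeasure_eq_measure M.emeasure_eq_measure)
qed

text \<open>The sets are level bands of height \<open>e\<close>. Uniform approximation is wanted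
  because averages and integrals against probability measures are contractions for the sup
  norm.\<close>

lemma bounded_measurable_simple_approx:
  fixes F :: "'a::topological_space \<Rightarrow> real"
  assumes "bounded_measurable F" "e > 0"
  obtains I :: "int set" and c A where "finite I" "\<And>i. A i \<in> sets borel"
    "\<And>x. \<bar>F x - (\<Sum>i\<in>I. c i * indicator (A i) x)\<bar> \<le> e"
proof -
  obtain B where B: "B \<ge> 0" "\<And>x. \<bar>F x\<bar> \<le> B" using assms(1) by (rule bounded_measurableE) auto
  note [measurable] = bounded_measurable_measurable[OF assms(1)]
  define m where "m = \<lceil>B / e\<rceil> + 1"
  define A where "A i = {x. real_of_int i * e \<le> F x \<and> F x < (real_of_int i + 1) * e}" for i :: int
  have fl: "x \<in> A i \<longleftrightarrow> \<lfloor>F x / e\<rfloor> = i" for x i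
    using assms(2) unfolding A_def by (simp add: floor_eq_iff field_simps)
  show ?thesis
  proof (rule that[of "{-m..m}" A "\<lambda>i. real_of_int i * e"])
    show "A i \<in> sets borel" for i unfolding A_def by measurable
    fix x
    define j where "j = \<lfloor>F x / e\<rfloor>"
    have "F x / e \<le> B / e" "- (B / e) \<le> F x / e"
      using B(2)[of x] assms(2) divide_right_mono[of "F x" B e] divide_right_mono[of "- B" "F x" e]
      by (auto simp: abs_le_iff)
    then have "j \<le> m" "-m \<le> j" unfolding j_def m_def by linarith+
    then have "j \<in> {-m..m}" by simp
    then have "(\<Sum>i\<in>{-m..m}. real_of_int i * e * indicator (A i) x) = real_of_int j * e"
      by (simp add: indicator_def fl flip: j_def)
    moreover have "real_of_int j * e \<le> F x" "F x \<le> real_of_int j * e + e"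
      using fl[of x j] unfolding A_def by (auto simp: j_def[symmetric] algebra_simps)
    ultimately show "\<bar>F x - (\<Sum>i\<in>{-m..m}. real_of_int i * e * indicator (A i) x)\<bar> \<le> e" by simp
  qed simp
qed

context compact_strong_feller
begin

section \<open>Cesaro averages along an orbit\<close>

definition avg :: "'a \<Rightarrow> nat \<Rightarrow> ('a \<Rightarrow> real) \<Rightarrow> real" where
  "avg x n F = (\<Sum>i<Suc n. (P ^^ i) F x) / Suc n"

lemma avg_bounds:
  assumes "bounded_measurable F" "\<And>y. a \<le> F y" "\<And>y. F y \<le> b"
  shows "a \<le> avg x n F" "avg x n F \<le> b"
proof -
  have "a \<le> (P ^^ i) F x" "(P ^^ i) F x \<le> b" for i
    using markov_op_bounds[OF markov_pow assms] by (auto simp: funpow_P assms)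
  then have "(\<Sum>i<Suc n. a) \<le> (\<Sum>i<Suc n. (P ^^ i) F x)" "(\<Sum>i<Suc n. (P ^^ i) F x) \<le> (\<Sum>i<Suc n. b)"
    by (blast intro: sum_mono)+
  then show "a \<le> avg x n F" "avg x n F \<le> b"
    unfolding avg_def by (simp_all add: field_simps del: sum.lessThan_Suc)
qed

lemma avg_add:
  "bounded_measurable F \<Longrightarrow> bounded_measurable G \<Longrightarrow>
    avg x n (\<lambda>y. F y + G y) = avg x n F + avg x n G"
  unfolding avg_def
  by (simp add: funpow_P bounded_measurable_add markov_op_add[OF markov_pow] sum.distrib
      add_divide_distrib del: sum.lessThan_Suc)

lemma avg_diff:
  "bounded_measurable F \<Longrightarrow> bounded_measurable G \<Longrightarrow>
    avg x n (\<lambda>y. F y - G y) = avg x n F - avg x n G"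
  unfolding avg_def
  by (simp add: funpow_P bounded_measurable_diff markov_op_diff[OF markov_pow] sum_subtractf
      diff_divide_distrib del: sum.lessThan_Suc)

lemma avg_sum:
  assumes "\<And>i. i \<in> I \<Longrightarrow> bounded_measurable (F i)"
  shows "avg x n (\<lambda>y. \<Sum>i\<in>I. c i * F i y) = (\<Sum>i\<in>I. c i * avg x n (F i))"
proof -
  have "(P ^^ j) (\<lambda>y. \<Sum>i\<in>I. c i * F i y) x = (\<Sum>i\<in>I. c i * (P ^^ j) (F i) x)" for j
    using assms by (simp add: funpow_P bounded_measurable_sum bounded_measurable_cmult
        markov_op_sum[OF markov_pow] markov_op_cmult)
  then show ?thesis
    unfolding avg_def sum_divide_distrib sum_distrib_left
    by (subst sum.swap) (simp add: sum_distrib_left sum_divide_distrib del: sum.lessThan_Suc)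
qed

lemma avg_contract:
  assumes "bounded_measurable F" "bounded_measurable G" "\<And>y. \<bar>F y - G y\<bar> \<le> e"
  shows "\<bar>avg x n F - avg x n G\<bar> \<le> e"
proof -
  have "- e \<le> F y - G y" "F y - G y \<le> e" for y using assms(3)[of y] by auto
  from avg_bounds[OF bounded_measurable_diff[OF assms(1,2)] this, of x n]
  show ?thesis by (simp add: avg_diff assms abs_le_iff)
qed

text \<open>Telescoping. For bounded \<open>F\<close> the defect is of order
  \<open>1 / Suc n\<close>, which is the source of invariance in the limit.\<close>

lemma avg_P:
  "avg x n (P F) - avg x n F = ((P ^^ Suc n) F x - F x) / Suc n"
proof -
  have "(P ^^ i) (P F) = (P ^^ Suc i) F" for i by (simp add: funpow_swap1)
  then have "(\<Sum>i<Suc n. (P ^^ i) (P F) x) - (\<Sum>i<Suc n. (P ^^ i) F x) = (P ^^ Suc n) F x - F x"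
    using sum_lessThan_telescope[of "\<lambda>i. (P ^^ i) F x" "Suc n"]
    by (simp add: sum_subtractf del: sum.lessThan_Suc funpow.simps(2))
  then show ?thesis unfolding avg_def by (simp add: diff_divide_distrib[symmetric] del: sum.lessThan_Suc funpow.simps)
qed

text \<open>Krylov--Bogoliubov without Riesz representation: along a subsequence, the Cesaro averages
  of \<open>P\<close> applied to indicators converge for all Borel sets at once, since Dini's theorem makes
  them equicontinuous at the empty set; the averages of \<open>P F\<close> and \<open>F\<close> are asymptotically equal.\<close>

lemma krylov_bogoliubov:
  obtains M r where "invariant_prob \<nu> M" "strict_mono r"
    "\<And>A. A \<in> sets borel \<Longrightarrow> (\<lambda>k. avg x (r k) (indicator A)) \<longlonglongrightarrow> measure M A"
proof -
  obtain B :: "'a set set" where B: "countable B" "topological_basis B"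
    using compact_metric_countable_basis[OF compact_UNIV] .
  obtain G :: "nat \<Rightarrow> 'a set" where G: "Int_stable (range G)" "sets borel = sigma_sets UNIV (range G)"
    using countable_borel_generator[OF B] .
  note ind = bounded_measurable_indicator
  have P_ind: "0 \<le> P (indicator A) y" "P (indicator A) y \<le> 1" if "A \<in> sets borel" for A y
    using markov_op_bounds[OF markov ind[OF that], of 0 1] by (auto simp: indicator_def)
  have avg_ind: "0 \<le> avg x n (indicator A)" "avg x n (indicator A) \<le> 1" if "A \<in> sets borel" for A n
    using avg_bounds[OF ind[OF that], of 0 1] by (auto simp: indicator_def)
  have Gs: "G i \<in> sets borel" for i unfolding G(2) by auto
  have "\<bar>avg x n (P (indicator (G i)))\<bar> \<le> 1" for n i
    using avg_bounds[OF bounded_measurable_P[OF ind[OF Gs]] P_ind[OF Gs], where x = x and n = n] by (simp add: abs_le_iff)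
  then obtain r where r: "strict_mono r" "\<And>i. convergent (\<lambda>k. avg x (r k) (P (indicator (G i))))"
    using bounded_diagonal_subsequence[of "\<lambda>n i. avg x n (P (indicator (G i)))" 1] by blast
  define a where "a k A = avg x (r k) (P (indicator A))" for k A
  have a_add: "a k (A \<union> C) = a k A + a k C"
    if "A \<in> sets borel" "C \<in> sets borel" "A \<inter> C = {}" for k A C
  proof -
    have "indicator (A \<union> C) = (\<lambda>y. indicator A y + indicator C y :: real)"
      using that(3) by (intro ext) (auto split: split_indicator)
    then show ?thesis unfolding a_def
      using that by (simp add: markov_op_add[OF markov] avg_add bounded_measurable_P ind)
  qed
  have a_nonneg: "0 \<le> a k A" if "A \<in> sets borel" for k A
    unfolding a_def using avg_bounds(1)[OF bounded_measurable_P[OF ind[OF that]] P_ind[OF that]] .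
  have equi: "\<exists>N. \<forall>i\<ge>N. \<forall>k. \<bar>a k (A i)\<bar> \<le> e"
    if A: "range A \<subseteq> sets borel" "decseq A" "(\<Inter>i. A i) = {}" "e > 0" for A e
  proof -
    have As: "A i \<in> sets borel" for i using A(1) by auto
    obtain N where N: "\<And>n y. n \<ge> N \<Longrightarrow> P (indicator (A n)) y < e"
    proof (rule P_uniform_null[of "\<lambda>n. indicator (A n)" 1 e])
      show "bounded_measurable (indicator (A n))" for n by (rule ind[OF As])
      show "indicator (A (Suc n)) y \<le> (indicator (A n) y :: real)" for n y
        using decseq_SucD[OF A(2), of n] by (auto split: split_indicator)
      show "(\<lambda>n. indicator (A n) y :: real) \<longlonglongrightarrow> 0" for y
      proof -
        obtain i where "y \<notin> A i" using A(3) by auto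
        then have "indicator (A n) y = (0 :: real)" if "n \<ge> i" for n
          using decseqD[OF A(2) that] by (auto simp: indicator_def)
        then show ?thesis by (intro tendsto_eventually) (auto simp: eventually_sequentially)
      qed
    qed (use A(4) in \<open>auto simp: indicator_def\<close>)
    have "\<bar>a k (A i)\<bar> \<le> e" if "i \<ge> N" for i k
      using avg_bounds[OF bounded_measurable_P[OF ind[OF As]] P_ind(1)[OF As] less_imp_le[OF N[OF that]]]
        a_nonneg[OF As] by (simp add: a_def)
    then show ?thesis by blast
  qed
  have conv: "convergent (\<lambda>k. a k A)" if "A \<in> sets borel" for A
  proof (rule convergent_sigma_sets[where a = a and G = "range G" and \<Omega> = UNIV])
    have "a k UNIV = 1" for k
      using avg_bounds[OF bounded_measurable_const[of "1::real"], of 1 1]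
      by (simp add: a_def indicator_def[abs_def] markov_op_const[OF markov] antisym)
    then show "convergent (\<lambda>k. a k UNIV)" by (simp add: convergent_const)
    show "convergent (\<lambda>k. a k A)" if "A \<in> range G" for A
      using r(2) that by (auto simp: a_def)
    show "a k (A \<union> C) = a k A + a k C"
      if "A \<in> sigma_sets UNIV (range G)" "C \<in> sigma_sets UNIV (range G)" "A \<inter> C = {}" for k A C
      using a_add that by (simp add: G(2))
    show "\<exists>i. \<forall>k. \<bar>a k (A i)\<bar> \<le> e"
      if "range A \<subseteq> sigma_sets UNIV (range G)" "decseq A" "(\<Inter>i. A i) = {}" "e > 0" for A e
      using equi[of A e] that unfolding G(2) by (meson order_refl)
  qed (use that G in auto)
  define m where "m A = lim (\<lambda>k. a k A)" for A
  have m: "(\<lambda>k. a k A) \<longlonglongrightarrow> m A" if "A \<in> sets borel" for A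
    using conv[OF that] unfolding m_def by (simp add: convergent_LIMSEQ_iff)
  have m_avg: "(\<lambda>k. avg x (r k) (indicator A)) \<longlonglongrightarrow> m A" if A: "A \<in> sets borel" for A
  proof -
    have "(\<lambda>k. a k A - avg x (r k) (indicator A)) \<longlonglongrightarrow> 0"
    proof (rule Lim_null_comparison)
      have "\<bar>(P ^^ n) (indicator A) x - indicator A x\<bar> \<le> 1" for n
        using markov_op_bounds[OF markov_pow ind[OF A], of 0 1 n x]
        by (auto simp: funpow_P ind A split: split_indicator)
      then have "\<bar>a k A - avg x (r k) (indicator A)\<bar> \<le> inverse (real (Suc (r k)))" for k
        using divide_right_mono[of _ 1 "real (Suc (r k))"]
        by (simp add: a_def avg_P abs_divide inverse_eq_divide del: funpow.simps of_nat_Suc)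
      then show "\<forall>\<^sub>F k in sequentially. norm (a k A - avg x (r k) (indicator A)) \<le> inverse (real (Suc (r k)))"
        by simp
      show "(\<lambda>k. inverse (real (Suc (r k)))) \<longlonglongrightarrow> 0"
        using LIMSEQ_subseq_LIMSEQ[OF LIMSEQ_inverse_real_of_nat r(1)] by (simp add: o_def)
    qed
    from tendsto_diff[OF m[OF A] this] show ?thesis by simp
  qed
  have m_nonneg: "0 \<le> m A" if "A \<in> sets borel" for A
    using m[OF that] a_nonneg[OF that] by (intro LIMSEQ_le_const) auto
  have m_add: "m (A \<union> C) = m A + m C" if "A \<in> sets borel" "C \<in> sets borel" "A \<inter> C = {}" for A C
  proof (rule LIMSEQ_unique)
    show "(\<lambda>k. a k (A \<union> C)) \<longlonglongrightarrow> m (A \<union> C)" using that by (intro m) auto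
    show "(\<lambda>k. a k (A \<union> C)) \<longlonglongrightarrow> m A + m C"
      using tendsto_add[OF m[OF that(1)] m[OF that(2)]] that by (simp add: a_add)
  qed
  have m_UNIV: "m UNIV = 1"
  proof (rule LIMSEQ_unique[OF m_avg])
    have "avg x n (indicator UNIV) = 1" for n
      using avg_bounds[OF bounded_measurable_const[of "1::real"], of 1 1]
      by (simp add: indicator_def[abs_def] antisym)
    then show "(\<lambda>k. avg x (r k) (indicator UNIV)) \<longlonglongrightarrow> 1" by simp
  qed simp
  \<comment> \<open>The threshold \<open>N\<close> does not depend on \<open>k\<close>, so
    continuity at the empty set survives the limit; with finite additivity it gives countable
    additivity.\<close>
  have m_cont: "(\<lambda>i. m (A i)) \<longlonglongrightarrow> 0"
    if A: "range A \<subseteq> sets borel" "decseq A" "(\<Inter>i. A i) = {}" for A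
  proof (rule LIMSEQ_I)
    fix e :: real assume "e > 0"
    obtain N where N: "\<And>i k. i \<ge> N \<Longrightarrow> \<bar>a k (A i)\<bar> \<le> e / 2"
      using equi[OF A, of "e / 2"] \<open>e > 0\<close> by auto
    have "norm (m (A i) - 0) < e" if "i \<ge> N" for i
    proof -
      have Ai: "A i \<in> sets borel" using A(1) by auto
      have "m (A i) \<le> e / 2"
        by (rule LIMSEQ_le_const2[OF m[OF Ai]]) (use N[OF that] in \<open>meson abs_le_D1\<close>)
      then show ?thesis using m_nonneg[OF Ai] \<open>e > 0\<close> by simp
    qed
    then show "\<exists>N. \<forall>i\<ge>N. norm (m (A i) - 0) < e" by blast
  qed
  define M where "M = measure_of UNIV (sets borel) (\<lambda>A. ennreal (m A))"
  have setsM: "sets M = sets borel" unfolding M_def by (metis sets.sets_measure_of_eq space_borel)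
  have "m {} = 0" using m_add[of "{}" "{}"] by simp
  then have pos: "positive (sets borel) (\<lambda>A. ennreal (m A))" by (simp add: positive_def)
  have emeasureM: "emeasure M A = ennreal (m A)" if "A \<in> sets borel" for A
    unfolding M_def
  proof (rule emeasure_measure_of_sigma[OF _ pos _ that])
    show "sigma_algebra UNIV (sets (borel :: 'a measure))"
      using sets.sigma_algebra_axioms[of "borel :: 'a measure"] by simp
    have "ring_of_sets UNIV (sets (borel :: 'a measure))"
      using sets.ring_of_sets_axioms[of "borel :: 'a measure"] by simp
    then show "countably_additive (sets borel) (\<lambda>A. ennreal (m A))"
    proof (rule ring_of_sets.empty_continuous_imp_countably_additive[OF _ pos])
      show "additive (sets borel) (\<lambda>A. ennreal (m A))"
        unfolding additive_def by (auto simp: m_add m_nonneg)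
      show "(\<lambda>i. ennreal (m (A i))) \<longlonglongrightarrow> 0"
        if "range A \<subseteq> sets borel" "decseq A" "(\<Inter>i. A i) = {}" for A
        using tendsto_ennrealI[OF m_cont[OF that]] by simp
    qed simp
  qed
  have spaceM: "space M = UNIV" using sets_eq_imp_space_eq[OF setsM] by simp
  have M: "prob_space M" by (rule prob_spaceI) (simp add: spaceM emeasureM m_UNIV)
  have measureM: "measure M A = m A" if "A \<in> sets borel" for A
    using that by (simp add: measure_def emeasureM m_nonneg)
  \<comment> \<open>Invariance tests the limit against \<open>P (indicator A)\<close>, in general no
    indicator, so convergence on sets has to be extended to functions.\<close>
  have integralM: "(\<lambda>k. avg x (r k) F) \<longlonglongrightarrow> (\<integral>y. F y \<partial>M)" if F: "bounded_measurable F" for F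
  proof (rule LIMSEQ_I)
    fix e :: real assume "e > 0"
    obtain I :: "int set" and c A where s: "finite I" "\<And>i. A i \<in> sets borel"
      "\<And>x. \<bar>F x - (\<Sum>i\<in>I. c i * indicator (A i) x)\<bar> \<le> e / 4"
      using bounded_measurable_simple_approx[OF F divide_pos_pos[OF \<open>e > 0\<close> zero_less_numeral]]
      by metis
    define S where "S y = (\<Sum>i\<in>I. c i * indicator (A i) y)" for y
    have S: "bounded_measurable S" unfolding S_def using s(2) by (intro bounded_measurable_intros)
    have "(\<integral>y. S y \<partial>M) = (\<Sum>i\<in>I. c i * m (A i))"
      unfolding S_def using s(1,2) integrable_bounded_measurable[OF M setsM ind]
      by (subst Bochner_Integration.integral_sum) (auto simp: measureM setsM spaceM)
    moreover have "(\<lambda>k. avg x (r k) S) \<longlonglongrightarrow> (\<Sum>i\<in>I. c i * m (A i))"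
      unfolding S_def using s(2) by (simp add: avg_sum ind tendsto_sum tendsto_mult_left m_avg)
    ultimately obtain K where K: "\<And>k. k \<ge> K \<Longrightarrow> \<bar>avg x (r k) S - (\<integral>y. S y \<partial>M)\<bar> < e / 4"
      using LIMSEQ_D[of "\<lambda>k. avg x (r k) S" "\<integral>y. S y \<partial>M" "e / 4"] \<open>e > 0\<close> by auto
    have "norm (avg x (r k) F - (\<integral>y. F y \<partial>M)) < e" if "k \<ge> K" for k
      using K[OF that] avg_contract[OF F S s(3)[folded S_def], of x "r k"]
        integral_abs_diff_le[OF M setsM F S s(3)[folded S_def]] \<open>e > 0\<close>
      unfolding real_norm_def by linarith
    then show "\<exists>K. \<forall>k\<ge>K. norm (avg x (r k) F - (\<integral>y. F y \<partial>M)) < e" by blast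
  qed
  show ?thesis
  proof (rule that[of M r])
    show "invariant_prob \<nu> M"
    proof (rule invariant_probI[OF markov M setsM])
      fix A :: "'a set" assume A: "A \<in> sets borel"
      show "(\<integral>y. P (indicator A) y \<partial>M) = measure M A"
        using LIMSEQ_unique[OF integralM[OF bounded_measurable_P[OF ind[OF A]]] m[OF A, unfolded a_def]]
        by (simp add: measureM[OF A])
    qed
    show "(\<lambda>k. avg x (r k) (indicator A)) \<longlonglongrightarrow> measure M A" if "A \<in> sets borel" for A
      using m_avg[OF that] by (simp add: measureM that)
  qed (rule r)
qed

text \<open>By \<open>le\<close> the iterates decrease, so their limit at \<open>x\<close> is below
  every Cesaro mean. Hence it is at most the mass that a limiting invariant measure started from
  \<open>x\<close> gives to \<open>N\<close>; by uniqueness that mass is 0.\<close>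

lemma transient_uniform_null:
  assumes unique: "\<And>M. invariant_prob \<nu> M \<Longrightarrow> M = \<rho>" and N: "N \<in> sets borel" "measure \<rho> N = 0"
    and le: "\<And>x. P (indicator N) x \<le> indicator N x" and "e > 0"
  obtains K where "\<And>n x. n \<ge> K \<Longrightarrow> (P ^^ n) (indicator N) x < e"
proof -
  note ind = bounded_measurable_indicator[OF N(1)]
  have dec: "(P ^^ Suc n) (indicator N) x \<le> (P ^^ n) (indicator N) x" for n x
    using markov_op_mono[OF markov_pow bounded_measurable_P[OF ind] ind le, of n x]
    by (simp only: funpow_P[OF ind, symmetric] funpow_P[OF bounded_measurable_P[OF ind], symmetric]
        funpow_Suc_right o_apply)
  have nonneg: "0 \<le> (P ^^ n) (indicator N) x" for n x
    using markov_op_bounds(1)[OF markov_pow ind, of 0 1] by (simp add: funpow_P ind indicator_def)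
  have "(\<lambda>n. (P ^^ n) (indicator N) x) \<longlonglongrightarrow> 0" for x
  proof -
    have "decseq (\<lambda>n. (P ^^ n) (indicator N) x)" using dec by (intro decseq_SucI)
    then obtain l where l: "(\<lambda>n. (P ^^ n) (indicator N) x) \<longlonglongrightarrow> l" "\<And>n. l \<le> (P ^^ n) (indicator N) x"
      using nonneg decseq_convergent[of _ 0] by blast
    obtain M r where M: "invariant_prob \<nu> M" "strict_mono r"
      "\<And>A. A \<in> sets borel \<Longrightarrow> (\<lambda>k. avg x (r k) (indicator A)) \<longlonglongrightarrow> measure M A"
      using krylov_bogoliubov by blast
    have "l \<le> avg x n (indicator N)" for n
    proof -
      have "(\<Sum>i<Suc n. l) \<le> (\<Sum>i<Suc n. (P ^^ i) (indicator N) x)" by (rule sum_mono) (rule l)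
      then show ?thesis unfolding avg_def by (simp add: field_simps del: sum.lessThan_Suc)
    qed
    then have "l \<le> measure M N" using M(3)[OF N(1)] by (intro LIMSEQ_le_const) auto
    then have "l \<le> 0" using unique[OF M(1)] N(2) by simp
    moreover have "0 \<le> l" using l(1) nonneg by (intro LIMSEQ_le_const) auto
    ultimately show ?thesis using l(1) by simp
  qed
  \<comment> \<open>The indicator itself need not be continuous, so Dini's theorem is used from the
    first iterate on.\<close>
  then have "(\<lambda>n. (P ^^ Suc n) (indicator N) x) \<longlonglongrightarrow> 0" for x by (rule LIMSEQ_Suc)
  then obtain K where "\<And>n x. n \<ge> K \<Longrightarrow> (P ^^ Suc n) (indicator N) x < e"
    using dini[OF compact_UNIV, of "\<lambda>n. (P ^^ Suc n) (indicator N)"]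
      continuous_funpow_Suc[OF ind] dec \<open>e > 0\<close> by metis
  then show ?thesis
    by (intro that[of "Suc K"]) (metis Suc_le_D Suc_le_mono)
qed

end

section \<open>Recurrent functions under unique ergodicity of all powers\<close>

definition msupport :: "'a::topological_space measure \<Rightarrow> 'a set" where
  "msupport M = {x. \<forall>U. open U \<longrightarrow> x \<in> U \<longrightarrow> measure M U > 0}"

lemma closed_msupport: "closed (msupport M)"
proof -
  have "- msupport M = \<Union>{U. open U \<and> \<not> measure M U > 0}" by (auto simp: msupport_def)
  then show ?thesis by (simp add: closed_def open_Union)
qed

text \<open>Second countability is essential: the complement is covered by the null basis sets,
  which are countably many.\<close>

lemma measure_compl_msupport:
  assumes "compact (UNIV :: 'a::metric_space set)" "prob_space M" "sets M = sets (borel :: 'a measure)"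
  shows "measure M (- msupport M) = 0"
proof -
  interpret prob_space M by fact
  obtain B :: "'a set set" where B: "countable B" "topological_basis B"
    using compact_metric_countable_basis[OF assms(1)] .
  define B0 where "B0 = {b \<in> B. measure M b = 0}"
  have op: "open b" if "b \<in> B" for b using B(2) that by (rule topological_basis_open)
  have sub: "- msupport M \<subseteq> (\<Union>b\<in>B0. b)"
  proof
    fix x assume "x \<in> - msupport M"
    then obtain U where U: "open U" "x \<in> U" "measure M U = 0"
      using zero_less_measure_iff by (auto simp: msupport_def)
    obtain b where b: "b \<in> B" "x \<in> b" "b \<subseteq> U"
      using topological_basisE[OF B(2) U(1,2)] .
    have "measure M b \<le> measure M U"
      using b(3) U(1) by (intro finite_measure_mono) (auto simp: assms(3))
    with U(3) have "measure M b = 0" by (simp add: measure_le_0_iff)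
    with b show "x \<in> (\<Union>b\<in>B0. b)" by (auto simp: B0_def)
  qed
  have "(\<Union>b\<in>B0. b) \<in> null_sets M"
    using B(1) op by (intro null_sets_UN')
      (auto simp: B0_def null_sets_def assms(3) emeasure_eq_measure)
  then have "- msupport M \<in> null_sets M"
    by (rule null_sets_subset[OF _ _ sub]) (simp add: assms(3) closed_msupport borel_open open_Compl)
  then show ?thesis by (simp add: measure_def null_sets_def)
qed

text \<open>The set where \<open>f\<close> is positive is open and null, so it misses the support.
  This turns identities valid almost everywhere into identities at every point of the
  support.\<close>

lemma zero_on_msupport:
  fixes f :: "'a::topological_space \<Rightarrow> real"
  assumes M: "prob_space M" "sets M = sets borel" and f: "continuous_on UNIV f" "bounded_measurable f"
    and nonneg: "\<And>x. 0 \<le> f x" and le: "(\<integral>x. f x \<partial>M) \<le> 0" and "x \<in> msupport M"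
  shows "f x = 0"
proof (rule ccontr)
  interpret prob_space M by fact
  have "(\<integral>x. f x \<partial>M) = 0" using le nonneg by (intro antisym integral_nonneg) auto
  then have ae: "AE x in M. f x = 0"
    using integral_nonneg_eq_0_iff_AE[OF integrable_bounded_measurable[OF M f(2)]] nonneg by simp
  assume "f x \<noteq> 0"
  then have "x \<in> {x. 0 < f x}" using nonneg[of x] by simp
  moreover have "open {x. 0 < f x}" using f(1) by (intro open_Collect_less continuous_on_const)
  ultimately have "measure M {x. 0 < f x} > 0" using assms(7) by (auto simp: msupport_def)
  moreover have "measure M {x. 0 < f x} = 0"
    using ae \<open>open {x. 0 < f x}\<close> sets_eq_imp_space_eq[OF M(2)]
    by (subst prob_eq_0) (auto simp: M(2))
  ultimately show False by simp
qed

text \<open>Equality in Jensen's inequality holds \<open>M\<close>-almost everywhere, and by the strong Feller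
  property everywhere on the support.\<close>

lemma deterministic_on_msupport:
  fixes \<kappa> :: "'a::metric_space \<Rightarrow> 'a measure"
  assumes \<kappa>: "markov_kernel \<kappa>" "strong_feller \<kappa>" "invariant_prob \<kappa> M"
    and G: "bounded_measurable G" "(\<integral>x. (G x)\<^sup>2 \<partial>M) \<le> (\<integral>x. (markov_op \<kappa> G x)\<^sup>2 \<partial>M)"
    and "x \<in> msupport M"
  shows "AE y in \<kappa> x. G y = markov_op \<kappa> G x"
proof -
  have M: "prob_space M" "sets M = sets borel" using \<kappa>(3) by (auto simp: invariant_prob_def)
  note G2 = bounded_measurable_power2[OF G(1)]
  note bm = bounded_measurable_markov_op[OF \<kappa>(1)]
  define V where "V x = markov_op \<kappa> (\<lambda>y. (G y)\<^sup>2) x - (markov_op \<kappa> G x)\<^sup>2" for x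
  have Vbm: "bounded_measurable V" unfolding V_def by (intro bounded_measurable_intros bm G2 G)
  have "V x = 0"
  proof (rule zero_on_msupport[OF M _ Vbm _ _ assms(6)])
    show "continuous_on UNIV V" unfolding V_def
      using \<kappa>(2) G(1) G2 by (intro continuous_intros) (auto simp: strong_feller_def)
    show "0 \<le> V x" for x unfolding V_def using markov_op_power2_le(2)[OF \<kappa>(1) G(1)] by simp
    have "(\<integral>x. V x \<partial>M) = (\<integral>x. markov_op \<kappa> (\<lambda>y. (G y)\<^sup>2) x \<partial>M) - (\<integral>x. (markov_op \<kappa> G x)\<^sup>2 \<partial>M)"
      unfolding V_def
      by (intro Bochner_Integration.integral_diff integrable_bounded_measurable[OF M]
          bounded_measurable_power2 bm G2 G)
    then show "(\<integral>x. V x \<partial>M) \<le> 0"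
      using G(2) invariant_prob_integral[OF \<kappa>(1,3) G2] by simp
  qed
  then have "(\<integral>y. (G y - markov_op \<kappa> G x)\<^sup>2 \<partial>\<kappa> x) = 0"
    using markov_op_power2_le(1)[OF \<kappa>(1) G(1), of x] by (simp add: V_def markov_op_def)
  moreover have "integrable (\<kappa> x) (\<lambda>y. (G y - markov_op \<kappa> G x)\<^sup>2)"
    by (intro integrable_markov_kernel[OF \<kappa>(1)] bounded_measurable_power2 bounded_measurable_diff
        bounded_measurable_const G)
  ultimately have "AE y in \<kappa> x. (G y - markov_op \<kappa> G x)\<^sup>2 = 0"
    by (subst (asm) integral_nonneg_eq_0_iff_AE) auto
  then show ?thesis by simp
qed

text \<open>The probability of leaving the support is continuous in the starting point, and by
  invariance its integral is the mass off the support, namely 0.\<close>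

lemma AE_msupport:
  fixes \<kappa> :: "'a::metric_space \<Rightarrow> 'a measure"
  assumes "compact (UNIV :: 'a set)"
    and \<kappa>: "markov_kernel \<kappa>" "strong_feller \<kappa>" "invariant_prob \<kappa> M" and "x \<in> msupport M"
  shows "markov_op \<kappa> (indicator (- msupport M)) x = 0" "AE y in \<kappa> x. y \<in> msupport M"
proof -
  have M: "prob_space M" "sets M = sets borel" using \<kappa>(3) by (auto simp: invariant_prob_def)
  have N: "- msupport M \<in> sets borel" by (simp add: closed_msupport borel_open open_Compl)
  note ind = bounded_measurable_indicator[OF N]
  show *: "markov_op \<kappa> (indicator (- msupport M)) x = 0"
  proof (rule zero_on_msupport[OF M _ bounded_measurable_markov_op[OF \<kappa>(1) ind] _ _ assms(5)])
    show "continuous_on UNIV (markov_op \<kappa> (indicator (- msupport M)))"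
      using \<kappa>(2) ind by (simp add: strong_feller_def)
    show "0 \<le> markov_op \<kappa> (indicator (- msupport M)) y" for y
      by (simp add: markov_op_indicator[OF \<kappa>(1) N])
    have "(\<integral>y. indicator (- msupport M) y \<partial>M) = measure M (- msupport M)"
      using N sets_eq_imp_space_eq[OF M(2)] M(2) by simp
    then show "(\<integral>y. markov_op \<kappa> (indicator (- msupport M)) y \<partial>M) \<le> 0"
      using invariant_prob_integral[OF \<kappa>(1,3) ind] measure_compl_msupport[OF assms(1) M] by simp
  qed
  interpret K: prob_space "\<kappa> x" by (rule markov_kernelD[OF \<kappa>(1)])
  have "- msupport M \<in> null_sets (\<kappa> x)"
    using * N by (simp add: markov_op_indicator[OF \<kappa>(1) N] null_sets_def K.emeasure_eq_measure
        markov_kernelD[OF \<kappa>(1)])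
  from AE_not_in[OF this] show "AE y in \<kappa> x. y \<in> msupport M" by simp
qed

text \<open>Among finitely many values, a return within less than \<open>d\<close> is an exact
  return.\<close>

lemma finite_set_gap:
  assumes "finite (V :: real set)"
  obtains d where "d > 0" "\<And>v w. v \<in> V \<Longrightarrow> w \<in> V \<Longrightarrow> \<bar>v - w\<bar> < d \<Longrightarrow> v = w"
proof -
  have "finite ((\<lambda>(v, w). v - w) ` (V \<times> V))" using assms by simp
  from finite_set_avoid[OF this, of 0] obtain d where
    d: "d > 0" "\<forall>x\<in>(\<lambda>(v, w). v - w) ` (V \<times> V). x \<noteq> 0 \<longrightarrow> d \<le> dist 0 x" by blast
  show ?thesis
  proof (rule that[OF d(1)])
    fix v w assume vw: "v \<in> V" "w \<in> V" "\<bar>v - w\<bar> < d"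
    then have "v - w \<noteq> 0 \<longrightarrow> d \<le> dist 0 (v - w)" using d(2) by blast
    with vw(3) show "v = w" by auto
  qed
qed

text \<open>Abstracts the time 1 operator of the semigroup. Uniqueness for every power excludes a
  cyclic decomposition of the support.\<close>

locale uniquely_ergodic_powers = compact_strong_feller +
  fixes \<rho>
  assumes unique_powers: "n > 0 \<Longrightarrow> unique_invariant_prob (kernel_pow \<nu> n) \<rho>"
begin

abbreviation S where "S \<equiv> msupport \<rho>"

text \<open>What remains of being a limit point of an orbit. Arbitrarily late times matter: they
  exceed any time at which energy is compared and outlast the transient mass off the
  support.\<close>

definition recurrent :: "('a \<Rightarrow> real) \<Rightarrow> bool" where
  "recurrent G \<longleftrightarrow> bounded_measurable G \<and> (\<forall>e>0. \<forall>m. \<exists>n\<ge>m. \<forall>x. \<bar>(P ^^ n) G x - G x\<bar> \<le> e)"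

lemma recurrent_bm: "recurrent G \<Longrightarrow> bounded_measurable G"
  by (simp add: recurrent_def)

lemma recurrentD:
  assumes "recurrent G" "e > 0"
  obtains n where "n \<ge> m" "\<And>x. \<bar>(P ^^ n) G x - G x\<bar> \<le> e"
  using assms unfolding recurrent_def by blast

lemma invariant_pow: "n > 0 \<Longrightarrow> invariant_prob (kernel_pow \<nu> n) \<rho>"
  using unique_powers by (simp add: unique_invariant_prob_def)

lemma kernel_pow_1: "kernel_pow \<nu> 1 = \<nu>"
  using markov_kernel_eqI[OF markov_pow markov, of 1] funpow_P[of _ 1] by simp

lemma invariant_nu: "invariant_prob \<nu> \<rho>"
  using invariant_pow[of 1] unfolding kernel_pow_1 by simp

lemma unique_nu: "invariant_prob \<nu> M \<Longrightarrow> M = \<rho>"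
  using unique_powers[of 1] unfolding kernel_pow_1 by (simp add: unique_invariant_prob_def)

lemma rho: "prob_space \<rho>" "sets \<rho> = sets borel"
  using invariant_nu by (auto simp: invariant_prob_def)

lemma feller_pow: "n > 0 \<Longrightarrow> strong_feller (kernel_pow \<nu> n)"
  unfolding strong_feller_def
proof (intro allI impI)
  fix F :: "'a \<Rightarrow> real" assume "n > 0" and F: "bounded_measurable F"
  then show "continuous_on UNIV (markov_op (kernel_pow \<nu> n) F) \<and>
      bounded (range (markov_op (kernel_pow \<nu> n) F))"
    using continuous_funpow_Suc[OF F, of "n - 1"] bounded_measurable_markov_op[OF markov_pow F, of n]
    by (simp add: funpow_P[OF F, symmetric] bounded_measurable_def del: funpow.simps)
qed

text \<open>If P^(r K) H is close to \<open>G\<close>, the contraction property carries this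
  closeness along \<open>r l - r K\<close> further steps to P^(r l) H, which is again close to
  \<open>G\<close>.\<close>

lemma recurrent_limit:
  assumes H: "continuous_on UNIV H" and r: "strict_mono r" and G: "continuous_on UNIV G"
    and lim: "uniform_limit UNIV (\<lambda>k. (P ^^ r k) H) G sequentially"
  shows "recurrent G"
  unfolding recurrent_def
proof (intro conjI allI impI)
  have bm: "bounded_measurable H" "bounded_measurable G"
    by (intro bounded_measurable_continuous[OF compact_UNIV] H G)+
  show "bounded_measurable G" by fact
  fix e :: real and m :: nat assume "e > 0"
  then obtain K where K: "\<And>k x. k \<ge> K \<Longrightarrow> dist ((P ^^ r k) H x) (G x) < e / 2"
    using lim[unfolded uniform_limit_sequentially_iff, rule_format, of "e / 2"] by (simp, blast)
  \<comment> \<open>Since \<open>r l\<close> is at least \<open>l\<close>, this secures both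
    \<open>l \<ge> K\<close> for closeness and a delay of at least \<open>m\<close>.\<close>
  define l where "l = r K + m + K"
  have l: "l \<ge> K" "r l \<ge> r K + m" using seq_suble[OF r, of l] by (auto simp: l_def)
  have "\<bar>(P ^^ (r l - r K)) G x - G x\<bar> \<le> e" for x
  proof -
    have eq: "(P ^^ r l) H = (P ^^ (r l - r K)) ((P ^^ r K) H)"
      using l(2) funpow_add[of "r l - r K" "r K" P] by simp
    have "\<bar>(P ^^ (r l - r K)) G x - (P ^^ (r l - r K)) ((P ^^ r K) H) x\<bar> \<le> e / 2"
      using K[of K] by (intro funpow_contract bm bounded_measurable_funpow)
        (auto simp: dist_real_def abs_minus_commute intro: less_imp_le)
    then show ?thesis using K[OF l(1), of x] unfolding dist_real_def eq by linarith
  qed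
  then show "\<exists>n\<ge>m. \<forall>x. \<bar>(P ^^ n) G x - G x\<bar> \<le> e" using l(2) by (intro exI[of _ "r l - r K"]) auto
qed

lemma recurrent_P:
  assumes "recurrent G" shows "recurrent (P G)"
  unfolding recurrent_def
proof (intro conjI allI impI)
  note bm = recurrent_bm[OF assms]
  show "bounded_measurable (P G)" by (rule bounded_measurable_P[OF bm])
  fix e :: real and m :: nat assume "e > 0"
  obtain n where n: "n \<ge> m" "\<And>x. \<bar>(P ^^ n) G x - G x\<bar> \<le> e"
    using recurrentD[OF assms \<open>e > 0\<close>, of m] by blast
  have "\<bar>(P ^^ n) (P G) x - P G x\<bar> \<le> e" for x
    using markov_op_contract[OF markov bounded_measurable_funpow[OF bm] bm n(2)]
    by (metis funpow_swap1)
  with n(1) show "\<exists>n\<ge>m. \<forall>x. \<bar>(P ^^ n) (P G) x - P G x\<bar> \<le> e" by blast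
qed

text \<open>Jensen and invariance make the energy nonincreasing, while recurrence brings it back at
  late times; no intermediate time can have lost any.\<close>

lemma recurrent_energy:
  assumes "recurrent G"
  shows "(\<integral>x. (G x)\<^sup>2 \<partial>\<rho>) \<le> (\<integral>x. ((P ^^ n) G x)\<^sup>2 \<partial>\<rho>)"
proof -
  note bm = recurrent_bm[OF assms]
  note bmn = bounded_measurable_funpow[OF bm]
  note int = integrable_bounded_measurable[OF rho]
  define E where "E n = (\<integral>x. ((P ^^ n) G x)\<^sup>2 \<partial>\<rho>)" for n
  obtain B where B: "B \<ge> 0" "\<And>x. \<bar>G x\<bar> \<le> B" using bm by (rule bounded_measurableE) auto
  have "E (Suc n) \<le> E n" for n
  proof -
    have "E (Suc n) \<le> (\<integral>x. P (\<lambda>y. ((P ^^ n) G y)\<^sup>2) x \<partial>\<rho>)"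
      unfolding E_def using markov_op_power2_le(2)[OF markov bmn]
      by (intro integral_mono int bounded_measurable_power2 bmn bounded_measurable_P) simp
    also have "\<dots> = E n" unfolding E_def
      by (rule invariant_prob_integral[OF markov invariant_nu bounded_measurable_power2[OF bmn]])
    finally show ?thesis .
  qed
  then have dec: "E n' \<le> E n" if "n \<le> n'" for n n' using lift_Suc_antimono_le[of E] that by blast
  have "E 0 \<le> E n"
  proof (rule field_le_epsilon)
    fix e :: real assume "e > 0"
    \<comment> \<open>A difference of squares factors into one term at most \<open>d\<close> and one
      at most \<open>2 * B\<close>; the summand 1 covers \<open>B = 0\<close>.\<close>
    define d where "d = e / (2 * B + 1)"
    have "d > 0" unfolding d_def using \<open>e > 0\<close> B(1) by simp
    obtain k where k: "k \<ge> n" "\<And>x. \<bar>(P ^^ k) G x - G x\<bar> \<le> d"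
      using recurrentD[OF assms \<open>d > 0\<close>, of n] by blast
    have "\<bar>(G x)\<^sup>2 - ((P ^^ k) G x)\<^sup>2\<bar> \<le> e" for x
    proof -
      have "\<bar>(G x)\<^sup>2 - ((P ^^ k) G x)\<^sup>2\<bar> = \<bar>G x - (P ^^ k) G x\<bar> * \<bar>G x + (P ^^ k) G x\<bar>"
        by (simp add: abs_mult[symmetric] power2_eq_square algebra_simps)
      also have "\<dots> \<le> d * (2 * B)"
        using k(2)[of x] B(2)[of x] funpow_abs_le[OF bm B(2), of k x] \<open>d > 0\<close>
        by (intro mult_mono) (auto simp: abs_minus_commute)
      also have "\<dots> \<le> d * (2 * B + 1)" using \<open>d > 0\<close> by simp
      also have "\<dots> = e" unfolding d_def using B(1) by simp
      finally show ?thesis .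
    qed
    from integral_abs_diff_le[OF rho bounded_measurable_power2[OF bm] bounded_measurable_power2[OF bmn] this]
    have "\<bar>E 0 - E k\<bar> \<le> e" by (simp add: E_def)
    then show "E 0 \<le> E n + e" using dec[OF k(1)] by linarith
  qed
  then show ?thesis by (simp add: E_def)
qed

lemma recurrent_deterministic:
  assumes "recurrent G" "n > 0" "x \<in> S"
  shows "AE y in kernel_pow \<nu> n x. G y = (P ^^ n) G x"
  using deterministic_on_msupport[OF markov_pow feller_pow[OF assms(2)] invariant_pow[OF assms(2)]
      recurrent_bm[OF assms(1)] _ assms(3)] recurrent_energy[OF assms(1), of n]
  by (simp add: funpow_P[OF recurrent_bm[OF assms(1)]])

lemma recurrent_deterministic_nu:
  assumes "recurrent G" "x \<in> S"
  shows "AE y in \<nu> x. G y = P G x"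
  using recurrent_deterministic[OF assms(1) _ assms(2), of 1] unfolding kernel_pow_1 by simp

text \<open>For \<open>x\<close> in the support, \<open>\<nu> x {G = a}\<close> is \<open>0\<close> or \<open>1\<close> according to whether \<open>P G x = a\<close>;
  by the strong Feller property, the level sets of \<open>P G\<close> form an open partition of the support.\<close>

lemma recurrent_finite_values:
  assumes "recurrent G" shows "finite (P G ` S)"
proof -
  note [measurable] = bounded_measurable_measurable[OF recurrent_bm[OF assms]]
  define A where "A a = {y. G y = a}" for a
  have A: "A a \<in> sets borel" for a unfolding A_def by measurable
  \<comment> \<open>Any threshold strictly between the possible values 0 and 1 would do; the strict
    inequality makes \<open>U a\<close> open.\<close>
  define U where "U a = {x. 1/2 < P (indicator (A a)) x}" for a
  have U: "x \<in> U a \<longleftrightarrow> P G x = a" if "x \<in> S" for x a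
  proof -
    interpret K: prob_space "\<nu> x" by (rule markov_kernelD[OF markov])
    note ae = recurrent_deterministic_nu[OF assms that]
    have s: "A a \<in> K.events" "space (\<nu> x) = UNIV" using A by (auto simp: markov_kernelD[OF markov])
    show ?thesis
    proof (cases "P G x = a")
      case True
      then have "measure (\<nu> x) (A a) = 1"
        using ae s by (subst K.prob_eq_1) (auto simp: A_def)
      with True show ?thesis by (simp add: U_def markov_op_indicator[OF markov A])
    next
      case False
      then have "measure (\<nu> x) (A a) = 0"
        using ae s by (subst K.prob_eq_0) (auto simp: A_def elim: AE_mp)
      with False show ?thesis by (simp add: U_def markov_op_indicator[OF markov A])
    qed
  qed
  have "compact S" using compact_Int_closed[OF compact_UNIV closed_msupport] by simp
  moreover have "open (U a)" for a unfolding U_def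
    by (intro open_Collect_less continuous_on_const continuous_P bounded_measurable_indicator A)
  moreover have "S \<subseteq> (\<Union>a\<in>P G ` S. U a)" using U by blast
  ultimately obtain D where D: "D \<subseteq> P G ` S" "finite D" "S \<subseteq> (\<Union>a\<in>D. U a)"
    by (meson compactE_image)
  have "P G ` S \<subseteq> D"
  proof (rule image_subsetI)
    fix x assume "x \<in> S"
    moreover from this obtain a where "a \<in> D" "x \<in> U a" using D(3) by blast
    ultimately show "P G x \<in> D" using U by simp
  qed
  then show ?thesis using D(2) by (rule finite_subset)
qed

text \<open>An almost sure property of a probability measure has a witness, here a point of
  \<open>S\<close> where \<open>G\<close> takes the value in question.\<close>

lemma recurrent_values:
  assumes "recurrent G" "x \<in> S"
  shows "(P ^^ n) G x \<in> G ` S"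
proof (cases "n = 0")
  case False
  interpret K: prob_space "kernel_pow \<nu> n x" by (rule markov_kernelD[OF markov_pow])
  have "AE y in kernel_pow \<nu> n x. y \<in> S \<and> G y = (P ^^ n) G x"
    using recurrent_deterministic[OF assms(1) _ assms(2)] False
      AE_msupport(2)[OF compact_UNIV markov_pow feller_pow invariant_pow assms(2)] by auto
  then have "\<exists>y. y \<in> S \<and> G y = (P ^^ n) G x"
    by (rule eventually_happens'[OF K.ae_filter_bot])
  then show ?thesis by (metis imageI)
qed (use assms in auto)

text \<open>The return is uniform, so one \<open>n\<close> brings all of \<open>S\<close> within
  less than the gap between values, and the approximate return becomes exact.\<close>

lemma recurrent_periodic_on_msupport:
  assumes "recurrent G"
  obtains n where "n > 0" "\<And>x. x \<in> S \<Longrightarrow> (P ^^ n) (P G) x = P G x"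
proof -
  note rec = recurrent_P[OF assms]
  obtain d where d: "d > 0"
    "\<And>v w. v \<in> P G ` S \<Longrightarrow> w \<in> P G ` S \<Longrightarrow> \<bar>v - w\<bar> < d \<Longrightarrow> v = w"
    using finite_set_gap[OF recurrent_finite_values[OF assms]] by blast
  obtain n where n: "n \<ge> 1" "\<And>x. \<bar>(P ^^ n) (P G) x - P G x\<bar> \<le> d / 2"
    using recurrentD[OF rec, of "d / 2" 1] d(1) by auto
  show ?thesis
  proof (rule that[of n])
    fix x assume "x \<in> S"
    show "(P ^^ n) (P G) x = P G x"
      using n(2)[of x] d(1) by (intro d(2) recurrent_values[OF rec] imageI \<open>x \<in> S\<close>) linarith
  qed (use n(1) in simp)
qed

text \<open>With \<open>P\<^sup>n (P G) = P G\<close> on the support, conditioning \<open>\<rho>\<close> on a level set of \<open>P G\<close> gives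
  another invariant measure of \<open>P\<^sup>n\<close>.\<close>

lemma recurrent_const_on_msupport:
  assumes "recurrent G"
  obtains a where "\<And>x. x \<in> S \<Longrightarrow> P G x = a"
proof -
  interpret rho: prob_space \<rho> by (rule rho)
  have space_rho: "space \<rho> = UNIV" using sets_eq_imp_space_eq[OF rho(2)] by simp
  note rec = recurrent_P[OF assms]
  have cont: "continuous_on UNIV (P G)" by (rule continuous_P[OF recurrent_bm[OF assms]])
  obtain n where n: "n > 0" "\<And>x. x \<in> S \<Longrightarrow> (P ^^ n) (P G) x = P G x"
    using recurrent_periodic_on_msupport[OF assms] by blast
  define \<kappa> where "\<kappa> = kernel_pow \<nu> n"
  have \<kappa>: "markov_kernel \<kappa>" "invariant_prob \<kappa> \<rho>" "\<And>M. invariant_prob \<kappa> M \<Longrightarrow> M = \<rho>"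
    using unique_powers[OF n(1)] by (auto simp: \<kappa>_def markov_pow unique_invariant_prob_def)
  have null: "measure \<rho> (- S) = 0" by (rule measure_compl_msupport[OF compact_UNIV rho])
  have N: "- S \<in> sets borel" by (simp add: closed_msupport borel_open open_Compl)
  have ae_S: "AE x in \<rho>. x \<in> S"
  proof -
    have "- S \<in> null_sets \<rho>" using null N by (simp add: null_sets_def rho(2) rho.emeasure_eq_measure)
    from AE_not_in[OF this] show ?thesis by simp
  qed
  have "S \<noteq> {}" using null rho.prob_space by (auto simp: space_rho)
  then obtain x0 where x0: "x0 \<in> S" by auto
  define a where "a = P G x0"
  define E where "E = {x. P G x = a}"
  have E: "E \<in> sets borel"
  proof -
    have "closed E" unfolding E_def by (intro closed_Collect_eq cont continuous_on_const)
    then show ?thesis by simp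
  qed
  have det: "AE y in \<kappa> x. y \<in> E \<longleftrightarrow> x \<in> E" if "x \<in> S" for x
    using recurrent_deterministic[OF rec n(1) that] n(2)[OF that]
    unfolding \<kappa>_def E_def by (auto elim: AE_mp)
  obtain d where d: "d > 0"
    "\<And>v w. v \<in> P G ` S \<Longrightarrow> w \<in> P G ` S \<Longrightarrow> \<bar>v - w\<bar> < d \<Longrightarrow> v = w"
    using finite_set_gap[OF recurrent_finite_values[OF assms]] by blast
  \<comment> \<open>The level set \<open>E\<close> is closed and might be null. The gap makes
    \<open>U\<close> an open neighbourhood of \<open>x0\<close> that meets \<open>S\<close> only in
    \<open>E\<close>, so \<open>E\<close> has positive mass.\<close>
  define U where "U = {x. \<bar>P G x - a\<bar> < d}"
  have "open U" unfolding U_def by (intro open_Collect_less continuous_intros cont)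
  then have "0 < measure \<rho> U" using x0 d(1) by (auto simp: msupport_def U_def a_def)
  also have "measure \<rho> U \<le> measure \<rho> (E \<union> - S)"
  proof (rule rho.finite_measure_mono)
    show "U \<subseteq> E \<union> - S" using d(2)[OF imageI imageI[OF x0]] by (auto simp: U_def E_def a_def)
  qed (use E N in \<open>auto simp: rho(2)\<close>)
  also have "\<dots> \<le> measure \<rho> E + measure \<rho> (- S)"
    using E N by (intro measure_Un_le) (auto simp: rho(2))
  finally have pos: "0 < measure \<rho> E" using null by simp
  define M where "M = uniform_measure \<rho> E"
  have setsM: "sets M = sets borel" by (simp add: M_def rho(2))
  have M: "prob_space M" unfolding M_def
    using pos by (intro prob_space_uniform_measure) (auto simp: rho.emeasure_eq_measure)
  have measureM: "measure M A = measure \<rho> (E \<inter> A) / measure \<rho> E" if "A \<in> sets borel" for A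
    unfolding M_def using that E pos by (intro measure_uniform_measure)
      (auto simp: rho(2) rho.emeasure_eq_measure)
  have "invariant_prob \<kappa> M"
  proof (rule invariant_probI[OF \<kappa>(1) M setsM])
    fix A :: "'a set" assume A: "A \<in> sets borel"
    have EA: "E \<inter> A \<in> sets borel" using E A by simp
    note bmA = bounded_measurable_markov_op[OF \<kappa>(1) bounded_measurable_indicator[OF A]]
    note bmEA = bounded_measurable_markov_op[OF \<kappa>(1) bounded_measurable_indicator[OF EA]]
    \<comment> \<open>From almost every start the step neither leaves nor enters \<open>E\<close>,
      so restricting to \<open>E\<close> before or after it is the same.\<close>
    have "AE x in \<rho>. indicator E x * markov_op \<kappa> (indicator A) x = markov_op \<kappa> (indicator (E \<inter> A)) x"
    proof (rule AE_mp[OF ae_S], rule AE_I2, rule impI)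
      fix x assume "x \<in> S"
      have "(\<integral>y. indicator E x * indicator A y \<partial>\<kappa> x) = (\<integral>y. indicator (E \<inter> A) y \<partial>\<kappa> x :: real)"
      proof (rule integral_cong_AE)
        show "AE y in \<kappa> x. indicator E x * indicator A y = (indicator (E \<inter> A) y :: real)"
          using det[OF \<open>x \<in> S\<close>] by (rule AE_mp) (auto split: split_indicator)
      qed (use A EA markov_kernelD[OF \<kappa>(1)] in auto)
      then show "indicator E x * markov_op \<kappa> (indicator A) x = markov_op \<kappa> (indicator (E \<inter> A)) x"
        by (simp add: markov_op_def)
    qed
    then have "(\<integral>x. indicator E x * markov_op \<kappa> (indicator A) x \<partial>\<rho>)
        = (\<integral>x. markov_op \<kappa> (indicator (E \<inter> A)) x \<partial>\<rho>)"
      using bounded_measurable_measurable[OF bmA] bounded_measurable_measurable[OF bmEA] E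
      by (intro integral_cong_AE) (auto simp: rho(2) cong: measurable_cong_sets)
    also have "\<dots> = (\<integral>x. indicator (E \<inter> A) x \<partial>\<rho>)"
      by (rule invariant_prob_integral[OF \<kappa>(1,2) bounded_measurable_indicator[OF EA]])
    also have "\<dots> = measure \<rho> (E \<inter> A)" using EA by (simp add: rho(2) space_rho)
    finally have *: "(\<integral>x. indicator E x * markov_op \<kappa> (indicator A) x \<partial>\<rho>) = measure \<rho> (E \<inter> A)" .
    have "(\<lambda>x. indicator E x / emeasure \<rho> E) = (\<lambda>x. ennreal (indicator E x / measure \<rho> E))"
      using pos by (auto simp: rho.emeasure_eq_measure divide_ennreal[symmetric] simp flip: ennreal_indicator)
    then have "M = density \<rho> (\<lambda>x. ennreal (indicator E x / measure \<rho> E))"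
      by (simp add: M_def uniform_measure_def)
    then have "(\<integral>x. markov_op \<kappa> (indicator A) x \<partial>M)
        = (\<integral>x. indicator E x / measure \<rho> E * markov_op \<kappa> (indicator A) x \<partial>\<rho>)"
      using bounded_measurable_measurable[OF bmA] E
      by (simp add: integral_real_density rho(2) cong: measurable_cong_sets)
    also have "\<dots> = (\<integral>x. indicator E x * markov_op \<kappa> (indicator A) x \<partial>\<rho>) / measure \<rho> E" by simp
    finally show "(\<integral>x. markov_op \<kappa> (indicator A) x \<partial>M) = measure M A"
      by (simp add: * measureM[OF A])
  qed
  then have "M = \<rho>" by (rule \<kappa>(3))
  moreover have "measure M E = 1" using measureM[OF E] pos by simp
  ultimately have "measure \<rho> E = 1" by simp
  then have compl: "measure \<rho> (- E) = 0"
    using rho.prob_compl[of E] E by (simp add: rho(2) space_rho Compl_eq_Diff_UNIV)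
  \<comment> \<open>A null open set contains no point of the support, so \<open>P G\<close> equals
    \<open>a\<close> on all of \<open>S\<close>.\<close>
  have "open (- E)" unfolding E_def
    by (intro open_Compl closed_Collect_eq cont continuous_on_const)
  have "P G x = a" if "x \<in> S" for x
  proof (rule ccontr)
    assume "P G x \<noteq> a"
    then have "x \<in> - E" by (simp add: E_def)
    with that \<open>open (- E)\<close> have "0 < measure \<rho> (- E)" by (auto simp: msupport_def)
    with compl show False by simp
  qed
  then show ?thesis by (rule that)
qed

text \<open>The distance of P^n (P G) from \<open>a\<close> is at most \<open>B\<close> times the
  mass still off \<open>S\<close>, which vanishes uniformly; recurrence transfers this to
  \<open>P G\<close> itself. Then P^n G equals \<open>a\<close> for every positive n, and returns of
  \<open>G\<close> force \<open>G\<close> to equal \<open>a\<close> too.\<close>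

lemma recurrent_const:
  assumes "recurrent G" shows "G x = G y"
proof -
  note bm = recurrent_bm[OF assms]
  note bmP = bounded_measurable_P[OF bm]
  obtain a where a: "\<And>x. x \<in> S \<Longrightarrow> P G x = a"
    using recurrent_const_on_msupport[OF assms] by blast
  obtain B where B: "B \<ge> 0" "\<And>x. \<bar>P G x - a\<bar> \<le> B"
    using bounded_measurable_diff[OF bmP bounded_measurable_const[of a]] by (rule bounded_measurableE) auto
  have N: "- S \<in> sets borel" by (simp add: closed_msupport borel_open open_Compl)
  note ind = bounded_measurable_indicator[OF N]
  have le: "P (indicator (- S)) x \<le> indicator (- S) x" for x
    using AE_msupport(1)[OF compact_UNIV markov feller invariant_nu, of x]
      markov_op_bounds(2)[OF markov ind, of 0 1 x] by (auto simp: indicator_def)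
  have PGa: "P G x = a" for x
  proof -
    have "\<bar>P G x - a\<bar> \<le> e" if "e > 0" for e
    proof -
      define d where "d = e / (2 * (B + 1))"
      have "d > 0" using that B(1) by (simp add: d_def)
      obtain K where K: "\<And>n x. n \<ge> K \<Longrightarrow> (P ^^ n) (indicator (- S)) x < d"
        using transient_uniform_null[OF unique_nu N measure_compl_msupport[OF compact_UNIV rho] le \<open>d > 0\<close>]
        by blast
      obtain n where n: "n \<ge> K" "\<And>x. \<bar>(P ^^ n) (P G) x - P G x\<bar> \<le> e / 2"
        using recurrentD[OF recurrent_P[OF assms] half_gt_zero[OF \<open>e > 0\<close>], of K] by blast
      let ?\<kappa> = "kernel_pow \<nu> n"
      have pw: "P G y - a \<le> B * indicator (- S) y" "(- B) * indicator (- S) y \<le> P G y - a" for y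
        using B(2)[of y] a[of y] by (auto simp: indicator_def abs_le_iff)
      have "markov_op ?\<kappa> (\<lambda>y. P G y - a) x \<le> markov_op ?\<kappa> (\<lambda>y. B * indicator (- S) y) x"
        "markov_op ?\<kappa> (\<lambda>y. (- B) * indicator (- S) y) x \<le> markov_op ?\<kappa> (\<lambda>y. P G y - a) x"
        by (intro markov_op_mono[OF markov_pow _ _ pw(1)] markov_op_mono[OF markov_pow _ _ pw(2)]
            bounded_measurable_diff bounded_measurable_cmult bounded_measurable_const bmP ind)+
      then have "\<bar>(P ^^ n) (P G) x - a\<bar> \<le> B * (P ^^ n) (indicator (- S)) x"
        unfolding markov_op_cmult
        by (simp add: markov_op_diff[OF markov_pow bmP bounded_measurable_const]
            markov_op_const[OF markov_pow] funpow_P[OF bmP] funpow_P[OF ind] abs_le_iff)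
      also have "\<dots> \<le> B * d" using K[OF n(1), of x] B(1) by (intro mult_left_mono) auto
      also have "\<dots> \<le> (B + 1) * d" using \<open>d > 0\<close> by simp
      also have "\<dots> = e / 2" using B(1) by (simp add: d_def field_simps)
      finally show ?thesis using n(2)[of x] by linarith
    qed
    then have "\<bar>P G x - a\<bar> \<le> 0" by (rule field_le_epsilon[of _ 0, simplified])
    then show ?thesis by simp
  qed
  have "\<bar>a - G z\<bar> \<le> e" if "e > 0" for e z
  proof -
    obtain n where n: "n \<ge> 1" "\<And>x. \<bar>(P ^^ n) G x - G x\<bar> \<le> e"
      using recurrentD[OF assms \<open>e > 0\<close>, of 1] by blast
    obtain k where "n = Suc k" using n(1) by (cases n) auto
    then have "(P ^^ n) G = (P ^^ k) (\<lambda>_. a)" using PGa by (simp add: funpow_Suc_right del: funpow.simps) presburger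
    also have "\<dots> = (\<lambda>_. a)"
      by (simp add: funpow_P bounded_measurable_const markov_op_const[OF markov_pow])
    finally show ?thesis using n(2)[of z] by simp
  qed
  then have "\<bar>a - G z\<bar> \<le> 0" for z by (rule field_le_epsilon[of _ 0, simplified])
  then have "G z = a" for z by (metis abs_le_zero_iff eq_iff_diff_eq_0)
  then show ?thesis by simp
qed

lemma geometric_ergodicity:
  obtains N where "N > 0" "\<And>k (F :: 'a \<Rightarrow> real) x y. bounded_measurable F \<Longrightarrow> (\<And>x. \<bar>F x\<bar> \<le> 1) \<Longrightarrow>
      \<bar>(P ^^ (k * N)) F x - (P ^^ (k * N)) F y\<bar> \<le> 2 * (1/2) ^ k"
  using geometric_mixing recurrent_const[OF recurrent_limit] by blast

end

section \<open>Exponential convergence in total variation\<close>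

lemma lipschitz_on_mult_bounded:
  fixes f g :: "'a::metric_space \<Rightarrow> real"
  assumes f: "L-lipschitz_on S f" "\<And>x. x \<in> S \<Longrightarrow> \<bar>f x\<bar> \<le> B"
    and g: "M-lipschitz_on S g" "\<And>x. x \<in> S \<Longrightarrow> \<bar>g x\<bar> \<le> C" and BC: "B \<ge> 0" "C \<ge> 0"
  shows "(B * M + C * L)-lipschitz_on S (\<lambda>x. f x * g x)"
proof (rule lipschitz_onI)
  fix x y assume xy: "x \<in> S" "y \<in> S"
  have "\<bar>f x * g x - f y * g y\<bar> \<le> \<bar>f x\<bar> * \<bar>g x - g y\<bar> + \<bar>g y\<bar> * \<bar>f x - f y\<bar>"
    using abs_triangle_ineq[of "f x * (g x - g y)" "g y * (f x - f y)"]
    by (simp add: abs_mult[symmetric] algebra_simps)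
  also have "\<dots> \<le> B * (M * dist x y) + C * (L * dist x y)"
    using lipschitz_onD[OF f(1) xy] lipschitz_onD[OF g(1) xy] f(2)[OF xy(1)] g(2)[OF xy(2)] BC
    by (intro add_mono mult_mono) (auto simp: dist_real_def)
  finally show "dist (f x * g x) (f y * g y) \<le> (B * M + C * L) * dist x y"
    by (simp add: dist_real_def algebra_simps)
qed (use lipschitz_on_nonneg[OF f(1)] lipschitz_on_nonneg[OF g(1)] BC in simp)

text \<open>Stone-Weierstrass: Lipschitz functions on a compact space are bounded, hence closed
  under products, and \<open>dist x\<close> separates \<open>x\<close> from every other
  point.\<close>

lemma lipschitz_dense:
  fixes f :: "'a::metric_space \<Rightarrow> real"
  assumes "compact (UNIV :: 'a set)" "continuous_on UNIV f" "e > 0"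
  obtains g L where "L-lipschitz_on UNIV g" "\<And>x. \<bar>f x - g x\<bar> < e"
proof -
  have "\<exists>g. (\<exists>L. L-lipschitz_on UNIV g) \<and> (\<forall>x\<in>UNIV. \<bar>f x - g x\<bar> < e)"
  proof (rule Stone_Weierstrass_HOL[OF assms(1) _ _ _ _ _ assms(2,3)])
    show "\<exists>L. L-lipschitz_on UNIV (\<lambda>x::'a. c::real)" for c
      using lipschitz_on_constant by blast
    show "continuous_on UNIV h" if "\<exists>L. L-lipschitz_on UNIV h" for h :: "'a \<Rightarrow> real"
      using that lipschitz_on_continuous_on by blast
    show "\<exists>L. L-lipschitz_on UNIV (\<lambda>x. h x + k x)"
      if "(\<exists>L. L-lipschitz_on UNIV h) \<and> (\<exists>L. L-lipschitz_on UNIV k)" for h k :: "'a \<Rightarrow> real"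
      using that lipschitz_on_add by blast
    show "\<exists>L. L-lipschitz_on UNIV (\<lambda>x. h x * k x)"
      if hk: "(\<exists>L. L-lipschitz_on UNIV h) \<and> (\<exists>L. L-lipschitz_on UNIV k)" for h k :: "'a \<Rightarrow> real"
    proof -
      have bm: "bounded_measurable h" "bounded_measurable k"
        using hk lipschitz_on_continuous_on bounded_measurable_continuous[OF assms(1)] by blast+
      obtain B where "B \<ge> 0" "\<And>x. \<bar>h x\<bar> \<le> B" using bm(1) by (rule bounded_measurableE) auto
      moreover obtain C where "C \<ge> 0" "\<And>x. \<bar>k x\<bar> \<le> C" using bm(2) by (rule bounded_measurableE) auto
      ultimately show ?thesis using hk lipschitz_on_mult_bounded by blast
    qed
    show "\<exists>h :: 'a \<Rightarrow> real. (\<exists>L. L-lipschitz_on UNIV h) \<and> h x \<noteq> h y"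
      if "x \<in> UNIV \<and> y \<in> UNIV \<and> x \<noteq> y" for x y :: 'a
    proof -
      have "\<bar>dist x u - dist x v\<bar> \<le> dist u v" for u v
        using dist_triangle[of x u v] dist_triangle[of x v u] by (simp add: dist_commute abs_le_iff)
      then have "1-lipschitz_on UNIV (dist x)" by (intro lipschitz_onI) (auto simp: dist_real_def)
      then show ?thesis using that by (intro exI[of _ "dist x"] conjI exI[of _ 1]) auto
    qed
  qed
  then show ?thesis using that by blast
qed

text \<open>Replacing a continuous \<open>H\<close> by a Lipschitz approximant costs the same error
  at all times, because iterates contract the sup norm. Limit points of the orbit of
  \<open>H\<close> thus take equal values at any two points.\<close>

lemma strong_feller_exponential_mixing:
  fixes \<nu> :: "'a::metric_space \<Rightarrow> 'a measure"
  assumes "compact (UNIV :: 'a set)" "markov_kernel \<nu>" "strong_feller \<nu>"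
    and stable: "\<And>\<phi> \<psi> F L. L-lipschitz_on UNIV F \<Longrightarrow>
      (\<lambda>N. \<bar>(markov_op \<nu> ^^ N) F \<phi> - (markov_op \<nu> ^^ N) F \<psi>\<bar>) \<longlonglongrightarrow> 0"
  shows "\<exists>C>0. \<exists>c>0. \<forall>N::nat.
    (SUP (\<phi>, \<psi>). tv_norm (diff_measure_fun
        ((markov_adjoint \<nu> ^^ N) (return borel \<phi>))
        ((markov_adjoint \<nu> ^^ N) (return borel \<psi>)))) \<le> ennreal (C * exp (- c * real N))"
proof -
  interpret compact_strong_feller \<nu> using assms(1-3) by unfold_locales
  have const: "G x = G y"
    if H: "continuous_on UNIV H" and r: "strict_mono r"
      and lim: "uniform_limit UNIV (\<lambda>k. (P ^^ r k) H) G sequentially" for H G r x y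
  proof -
    have "\<bar>G x - G y\<bar> \<le> e" if "e > 0" for e
    proof -
      have e4: "e / 4 > 0" using that by simp
      obtain F L where F: "L-lipschitz_on UNIV F" "\<And>x. \<bar>H x - F x\<bar> < e / 4"
        using lipschitz_dense[OF assms(1) H e4] by blast
      have bm: "bounded_measurable H" "bounded_measurable F"
        using H lipschitz_on_continuous_on[OF F(1)]
        by (auto intro: bounded_measurable_continuous[OF assms(1)])
      have close: "\<bar>(P ^^ n) H z - (P ^^ n) F z\<bar> \<le> e / 4" for n z
        using F(2) by (intro funpow_contract bm) (auto intro: less_imp_le)
      obtain K where K: "\<And>n. n \<ge> K \<Longrightarrow> \<bar>(P ^^ n) F x - (P ^^ n) F y\<bar> < e / 2"
        using LIMSEQ_D[OF stable[OF F(1), of x y] half_gt_zero[OF \<open>e > 0\<close>]] by auto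
      have "(\<lambda>k. (P ^^ r k) H z) \<longlonglongrightarrow> G z" for z using tendsto_uniform_limitI[OF lim] by simp
      then have "(\<lambda>k. \<bar>(P ^^ r k) H x - (P ^^ r k) H y\<bar>) \<longlonglongrightarrow> \<bar>G x - G y\<bar>"
        by (intro tendsto_intros)
      moreover have "\<bar>(P ^^ r k) H x - (P ^^ r k) H y\<bar> \<le> e" if "k \<ge> K" for k
      proof -
        have "r k \<ge> K" using that seq_suble[OF r, of k] by simp
        from K[OF this] close[of "r k" x] close[of "r k" y] show ?thesis by linarith
      qed
      ultimately show ?thesis by (intro LIMSEQ_le_const2) auto
    qed
    then have "\<bar>G x - G y\<bar> \<le> 0" by (rule field_le_epsilon[of _ 0, simplified])
    then show ?thesis by simp
  qed
  obtain N where N: "N > 0" "\<And>k F x y. bounded_measurable F \<Longrightarrow> (\<And>x. \<bar>F x\<bar> \<le> 1) \<Longrightarrow>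
      \<bar>(P ^^ (k * N)) F x - (P ^^ (k * N)) F y\<bar> \<le> 2 * (1/2) ^ k"
    using geometric_mixing const by blast
  have "tv_norm (diff_measure_fun (kernel_pow \<nu> n x) (kernel_pow \<nu> n y))
      \<le> ennreal (4 * exp (- (ln 2 / N) * real n))" for n x y
  proof (rule tv_norm_diff_measure_le)
    fix F :: "'a \<Rightarrow> real" assume F: "bounded_measurable F" "\<And>x. \<bar>F x\<bar> \<le> 1"
    \<comment> \<open>The remaining \<open>n mod N\<close> steps cannot increase the
      oscillation.\<close>
    have "\<bar>(P ^^ n) F x - (P ^^ n) F y\<bar> \<le> 2 * (1/2) ^ (n div N)"
      using funpow_osc_mono[OF F(1) N(2)[OF F]] by simp
    also have "\<dots> \<le> 4 * exp (- (ln 2 / N) * real n)"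
    proof (rule half_power_le_exp)
      have "n \<le> Suc (n div N) * N" using div_mult_mod_eq[of n N] mod_less_divisor[OF N(1), of n]
        unfolding mult_Suc by linarith
      then show "real n \<le> real (Suc (n div N)) * real N" by (metis of_nat_le_iff of_nat_mult)
    qed (use N(1) in simp)
    finally show "(\<integral>z. F z \<partial>kernel_pow \<nu> n x) - (\<integral>z. F z \<partial>kernel_pow \<nu> n y)
        \<le> 4 * exp (- (ln 2 / N) * real n)"
      by (simp add: funpow_P[OF F(1)] markov_op_def)
  qed (auto simp: markov_kernelD[OF markov_pow])
  then show ?thesis
    using N(1) unfolding kernel_pow_def
    by (intro exI[of _ 4] conjI exI[of _ "ln 2 / real N"] allI SUP_least) auto
qed

text \<open>By invariance the difference to be bounded is the \<open>\<rho>\<close>-average over y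
  of \<open>g y - g x\<close>, where \<open>g\<close> is \<open>F\<close> evolved for time
  \<open>t\<close>; so the oscillation of \<open>g\<close> suffices.\<close>

lemma strong_feller_semigroup_exponential_ergodicity:
  fixes \<nu> :: "real \<Rightarrow> 'a::metric_space \<Rightarrow> 'a measure"
  assumes "compact (UNIV :: 'a set)" "markov_semigroup \<nu>"
    and erg: "\<And>t. t > 0 \<Longrightarrow> strong_feller (\<nu> t) \<and> unique_invariant_prob (\<nu> t) \<rho>"
  shows "\<exists>C>0. \<exists>c>0. \<forall>t\<ge>0.
    (SUP \<phi>. tv_norm (diff_measure_fun \<rho> (markov_adjoint (\<nu> t) (return borel \<phi>))))
      \<le> ennreal (C * exp (- c * t))"
proof -
  have kernel: "markov_kernel (\<nu> t)" if "t \<ge> 0" for t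
    using assms(2) that by (simp add: markov_semigroup_def)
  have id: "markov_op (\<nu> 0) F = F" if "bounded_measurable F" for F
    using assms(2) that by (simp add: markov_semigroup_def)
  have add: "markov_op (\<nu> (t + s)) F = markov_op (\<nu> t) (markov_op (\<nu> s) F)"
    if "t \<ge> 0" "s \<ge> 0" "bounded_measurable F" for t s F
    using assms(2) that by (simp add: markov_semigroup_def)
  have pow_op: "(markov_op (\<nu> 1) ^^ n) F = markov_op (\<nu> (real n)) F" if "bounded_measurable F" for n F
    using add[of 1 "real _"] by (induction n) (simp_all add: id that)
  have pow: "kernel_pow (\<nu> 1) n = \<nu> (real n)" for n
    by (rule markov_kernel_eqI)
      (simp_all add: kernel markov_kernel_kernel_pow funpow_markov_op[symmetric] pow_op)
  interpret uniquely_ergodic_powers "\<nu> 1" \<rho>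
    by unfold_locales (use assms(1) kernel erg in \<open>auto simp: pow\<close>)
  obtain N where N: "N > 0" "\<And>k F x y. bounded_measurable F \<Longrightarrow> (\<And>x. \<bar>F x\<bar> \<le> 1) \<Longrightarrow>
      \<bar>(P ^^ (k * N)) F x - (P ^^ (k * N)) F y\<bar> \<le> 2 * (1/2) ^ k"
    using geometric_ergodicity by blast
  have "tv_norm (diff_measure_fun \<rho> (\<nu> t x)) \<le> ennreal (4 * exp (- (ln 2 / N) * t))"
    if t: "t \<ge> 0" for t x
  proof (rule tv_norm_diff_measure_le[OF rho])
    fix F :: "'a \<Rightarrow> real" assume F: "bounded_measurable F" "\<And>x. \<bar>F x\<bar> \<le> 1"
    define k where "k = nat \<lfloor>t / N\<rfloor>"
    \<comment> \<open>The remaining time \<open>s\<close> acts on \<open>F\<close> first and keeps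
      it bounded by 1, so the estimate for \<open>k * N\<close> steps applies to the result.\<close>
    define s where "s = t - real (k * N)"
    define g where "g = markov_op (\<nu> t) F"
    define e :: real where "e = 2 * (1/2) ^ k"
    have k: "real k \<le> t / N" "t / N \<le> real (Suc k)"
      using t real_of_int_floor_add_one_ge[of "t / N"] by (auto simp: k_def add.commute)
    then have s: "s \<ge> 0" "t \<le> real (Suc k) * N"
      using N(1) by (auto simp: s_def field_simps)
    have bms: "bounded_measurable (markov_op (\<nu> s) F)"
      by (rule bounded_measurable_markov_op[OF kernel[OF s(1)] F(1)])
    have "g = markov_op (\<nu> (real (k * N))) (markov_op (\<nu> s) F)"
      using add[of "real (k * N)" s F] s(1) F(1) by (simp add: g_def s_def)
    also have "\<dots> = (P ^^ (k * N)) (markov_op (\<nu> s) F)" by (rule pow_op[OF bms, symmetric])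
    finally have "\<bar>g y - g x\<bar> \<le> e" for y
      using N(2)[OF bms markov_op_abs_le[OF kernel[OF s(1)] F]] by (simp add: e_def)
    then have "g y \<le> g x + e" "g x - e \<le> g y" for y by (simp_all add: abs_le_iff algebra_simps)
    moreover have bmg: "bounded_measurable g"
      unfolding g_def by (rule bounded_measurable_markov_op[OF kernel[OF t] F(1)])
    ultimately have "(\<integral>y. g y \<partial>\<rho>) \<le> g x + e" by (intro integral_bounds(2)[OF rho bmg])
    moreover have "(\<integral>y. g y \<partial>\<rho>) = (\<integral>y. F y \<partial>\<rho>)"
    \<comment> \<open>Invariance is assumed at positive times only; at time 0 the operator is the
      identity.\<close>
    proof (cases "t = 0")
      case True
      then show ?thesis by (simp add: g_def id F)
    next
      case False
      then have "invariant_prob (\<nu> t) \<rho>" using erg[of t] t by (simp add: unique_invariant_prob_def)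
      from invariant_prob_integral[OF kernel[OF t] this F(1)] show ?thesis by (simp add: g_def)
    qed
    moreover have "e \<le> 4 * exp (- (ln 2 / N) * t)"
      unfolding e_def using N(1) s(2) by (intro half_power_le_exp) auto
    ultimately show "(\<integral>y. F y \<partial>\<rho>) - (\<integral>y. F y \<partial>\<nu> t x) \<le> 4 * exp (- (ln 2 / N) * t)"
      by (simp add: g_def markov_op_def)
  qed (auto simp: markov_kernelD[OF kernel[OF t]])
  then show ?thesis
    using N(1)
    by (intro exI[of _ 4] conjI exI[of _ "ln 2 / real N"] allI impI SUP_least)
      (auto simp: markov_adjoint_return[OF kernel])
qed

theorem theorem1p4:
  assumes "compact (UNIV :: 'a::metric_space set)"
  shows
    "(\<forall>(\<nu> :: real \<Rightarrow> 'a \<Rightarrow> 'a measure) \<rho>.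
        markov_semigroup \<nu> \<longrightarrow> strongly_continuous \<nu> \<longrightarrow>
        (\<forall>t>0. strong_feller (\<nu> t) \<and> unique_invariant_prob (\<nu> t) \<rho>) \<longrightarrow>
        (\<exists>C>0. \<exists>c>0. \<forall>t\<ge>0.
           (SUP \<phi>. tv_norm (diff_measure_fun \<rho> (markov_adjoint (\<nu> t) (return borel \<phi>))))
             \<le> ennreal (C * exp (- c * t))))
     \<and>
     (\<forall>(\<nu> :: 'a \<Rightarrow> 'a measure).
        markov_kernel \<nu> \<longrightarrow> strong_feller \<nu> \<longrightarrow>
        (\<forall>\<phi> \<psi> F. (\<exists>L. L-lipschitz_on UNIV F) \<longrightarrow>
           (\<lambda>N. \<bar>(markov_op \<nu> ^^ N) F \<phi> - (markov_op \<nu> ^^ N) F \<psi>\<bar>) \<longlonglongrightarrow> 0) \<longrightarrow>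
        (\<exists>C>0. \<exists>c>0. \<forall>N::nat.
           (SUP (\<phi>, \<psi>). tv_norm (diff_measure_fun
               ((markov_adjoint \<nu> ^^ N) (return borel \<phi>))
               ((markov_adjoint \<nu> ^^ N) (return borel \<psi>))))
             \<le> ennreal (C * exp (- c * real N))))"
proof (rule conjI; intro allI impI)
  fix \<nu> :: "real \<Rightarrow> 'a \<Rightarrow> 'a measure" and \<rho>
  assume "markov_semigroup \<nu>" "\<forall>t>0. strong_feller (\<nu> t) \<and> unique_invariant_prob (\<nu> t) \<rho>"
  then show "\<exists>C>0. \<exists>c>0. \<forall>t\<ge>0.
      (SUP \<phi>. tv_norm (diff_measure_fun \<rho> (markov_adjoint (\<nu> t) (return borel \<phi>))))
        \<le> ennreal (C * exp (- c * t))"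
    by (intro strong_feller_semigroup_exponential_ergodicity[OF assms]) auto
next
  fix \<nu> :: "'a \<Rightarrow> 'a measure"
  assume "markov_kernel \<nu>" "strong_feller \<nu>"
    and "\<forall>\<phi> \<psi> F. (\<exists>L. L-lipschitz_on UNIV F) \<longrightarrow>
      (\<lambda>N. \<bar>(markov_op \<nu> ^^ N) F \<phi> - (markov_op \<nu> ^^ N) F \<psi>\<bar>) \<longlonglongrightarrow> 0"
  then show "\<exists>C>0. \<exists>c>0. \<forall>N::nat.
      (SUP (\<phi>, \<psi>). tv_norm (diff_measure_fun
          ((markov_adjoint \<nu> ^^ N) (return borel \<phi>))
          ((markov_adjoint \<nu> ^^ N) (return borel \<psi>)))) \<le> ennreal (C * exp (- c * real N))"
    by (intro strong_feller_exponential_mixing[OF assms]) blast+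
qed

end
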